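(* Assume $m_k\le n_k+1$ for all $k\in\{1,\dots,M\}$ and $m_j=n_j+1$ for some $j$. Furthermore, assume that one of the following conditions is fulfilled: \begin{enumerate} \item $m_k>1$ for all $k$, and $\sum_{k\in M_4}\lambda_k r_k(t)e^{-Cm_k}>b(t)$ for all $t$. \item $m_k\ge 1$ for all $k$, $m_i=1$ for some $i$, and both $\sum_{k\in M_4}\lambda_k r_k(t)e^{-Cm_k}>b(t)$ and $\sum_{k\in M_2}\lambda_k r_k(t)e^{C}<b(t)$ for all $t$. \item $0<m_i<1$ for some $i$, and $\sum_{k\in M_4}\lambda_k r_k(t)e^{Cn_k}<b(t)$ for all $t$. \end{enumerate} Then the equation $$x'(t)=\sum_{k=1}^{M}\lambda_k r_k(t)\frac{x^{m_k}(t-\tau_k(t))}{1+x^{n_k}(t-\mu_k(t))}-b(t)x(t)$$ admits at least one positive $T$-periodic solution.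
   Context: Let $T>0$ and let $M\ge 1$ be an integer. For $k=1,\dots,M$, let $\lambda_k,m_k,n_k$ be positive real constants, and let $r_k,\tau_k,\mu_k$ and $b$ be continuous, positive, $T$-periodic functions $\mathbb{R}\to\mathbb{R}$. Set $C:=\int_0^T b(t)\,dt$, $M_2:=\{k: m_k=1\}$ and $M_4:=\{k: m_k=n_k+1\}$. Here $x^{m}(s)$ means $(x(s))^{m}$. A positive $T$-periodic solution is a $T$-periodic differentiable function $x:\mathbb{R}\to(0,\infty)$ satisfying the equation for all $t\in\mathbb{R}$. *)

theory Defs
  imports "HOL-Analysis.Analysis" "HOL-Library.Periodic_Fun"
begin

definition positive_periodic_coeff :: "real \<Rightarrow> (real \<Rightarrow> real) \<Rightarrow> bool" where
  "positive_periodic_coeff T f \<longleftrightarrow>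
     continuous_on UNIV f \<and> (\<forall>t. f t > 0) \<and> periodic_fun_simple f T"

(* Powers have real exponents, hence powr; the base is positive because x is. *)
definition positive_periodic_solution ::
  "real \<Rightarrow> nat \<Rightarrow> (nat \<Rightarrow> real) \<Rightarrow> (nat \<Rightarrow> real) \<Rightarrow> (nat \<Rightarrow> real) \<Rightarrow>
   (nat \<Rightarrow> real \<Rightarrow> real) \<Rightarrow> (nat \<Rightarrow> real \<Rightarrow> real) \<Rightarrow> (nat \<Rightarrow> real \<Rightarrow> real) \<Rightarrow>
   (real \<Rightarrow> real) \<Rightarrow> (real \<Rightarrow> real) \<Rightarrow> bool" where
  "positive_periodic_solution T M lam m n r \<tau> \<mu> b x \<longleftrightarrow>
     (\<forall>t. x t > 0) \<and> periodic_fun_simple x T \<and>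
     (\<forall>t. (x has_real_derivative
            ((\<Sum>k=1..M. lam k * r k t *
                (x (t - \<tau> k t) powr m k / (1 + x (t - \<mu> k t) powr n k)))
             - b t * x t)) (at t))"

end

theory Submission
  imports Defs "HOL-Complex_Analysis.Great_Picard"
begin

text \<open>
  Let \<open>\<Phi> x\<close> denote the sum in the equation and \<open>C\<close> the integral of \<open>b\<close> over a period. For every positive
  periodic \<open>x\<close> the linear equation \<open>y' = \<Phi> x - b y\<close> has one periodic solution; it satisfies
  \<open>y t \<ge> exp (- C) * y s\<close> for all \<open>s, t\<close>. Write it as \<open>y = \<rho> V\<close> with \<open>V 0 = 1\<close> and look for a solution \<open>x = r u\<close>
  with \<open>u 0 = 1\<close>, that is, for \<open>V = u\<close> and \<open>\<rho> = r\<close>. Schauder's theorem applied to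
  \<open>(u, r) \<mapsto> (V, r + \<sigma> * (\<rho> - r))\<close>, the second component being clipped to an interval \<open>[\<alpha>, \<beta>]\<close>, gives
  a fixed point for either sign \<open>\<sigma>\<close>; the choice \<open>\<sigma> = - 1\<close> turns the expansive (superlinear) cases 1 and 2
  into compressive ones. If \<open>\<rho> \<noteq> r\<close>, then \<open>r\<close> is an end point of the interval and \<open>x' = 0\<close> at a
  maximum \<open>X\<close> of \<open>x\<close> fixes the sign of \<open>\<Phi> x - b X\<close> there. The hypotheses on the coefficients
  exclude this sign when \<open>X\<close> is small, respectively large.
\<close>

section \<open>Limits of quotients of powers\<close>

text \<open>Dividing the equation by the maximum \<open>X\<close> of \<open>x\<close> leaves
  quotients of this type. Near 0 the denominator tends to 1 and the numerator survives only for
  \<open>m = 1\<close>; this is how \<open>M2\<close> enters.\<close>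

lemma tendsto_powr_quotient_at_0:
  fixes a m n :: real
  assumes "0 < a" "0 < n" "1 \<le> m"
  shows "((\<lambda>X. X powr (m - 1) / (1 + (a * X) powr n)) \<longlongrightarrow> of_bool (m = 1)) (at_right 0)"
proof -
  have pos: "\<forall>\<^sub>F X in at_right 0. 0 < (X :: real)"
    by (rule eventually_at_right_less)
  have "((\<lambda>X. X powr (m - 1)) \<longlongrightarrow> of_bool (m = 1)) (at_right 0)"
  proof (cases "m = 1")
    case True
    have "((\<lambda>X::real. X powr 0) \<longlongrightarrow> 1) (at_right 0)"
      by (rule tendsto_eventually, rule eventually_mono[OF pos]) simp
    with True show ?thesis by simp
  next
    case False
    have "((\<lambda>X::real. X powr (m - 1)) \<longlongrightarrow> 0) (at_right 0)"
      using assms(3) False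
      by (intro tendsto_zero_powrI[OF tendsto_ident_at tendsto_const] eventually_mono[OF pos]) auto
    with False show ?thesis by simp
  qed
  moreover have "((\<lambda>X. (a * X) powr n) \<longlongrightarrow> 0) (at_right 0)"
    using assms(1,2)
    by (intro tendsto_zero_powrI[OF _ tendsto_const] tendsto_mult_right_zero tendsto_ident_at
        eventually_mono[OF pos]) auto
  ultimately have "((\<lambda>X. X powr (m - 1) / (1 + (a * X) powr n)) \<longlongrightarrow> of_bool (m = 1) / (1 + 0)) (at_right 0)"
    by (intro tendsto_divide tendsto_add tendsto_const) auto
  then show ?thesis by simp
qed

text \<open>Multiplying numerator and denominator by \<open>X powr - n\<close> leaves the leading
  exponent \<open>m - 1 - n\<close>, which vanishes exactly for \<open>m = n + 1\<close>; this is
  how \<open>M4\<close> enters. The scale \<open>a\<close> is later \<open>exp (- C)\<close> or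
  1.\<close>

lemma tendsto_powr_quotient_at_top:
  fixes a m n :: real
  assumes "0 < a" "0 < n" "m \<le> n + 1"
  shows "((\<lambda>X. X powr (m - 1) / (1 + (a * X) powr n)) \<longlongrightarrow> of_bool (m = n + 1) * a powr - n) at_top"
proof -
  have "((\<lambda>X. X powr (m - 1 - n)) \<longlongrightarrow> of_bool (m = n + 1)) at_top"
  proof (cases "m = n + 1")
    case True
    have "((\<lambda>X::real. X powr 0) \<longlongrightarrow> 1) at_top"
      by (rule tendsto_eventually, rule eventually_mono[OF eventually_gt_at_top[of 0]]) simp
    with True show ?thesis by simp
  next
    case False
    with assms(3) have "m - 1 - n < 0" by simp
    from tendsto_neg_powr[OF this filterlim_ident] False show ?thesis by simp
  qed
  moreover have "((\<lambda>X::real. X powr - n) \<longlongrightarrow> 0) at_top"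
    using assms(2) by (intro tendsto_neg_powr filterlim_ident) simp
  ultimately have "((\<lambda>X. X powr (m - 1 - n) / (X powr - n + a powr n)) \<longlongrightarrow>
      of_bool (m = n + 1) / (0 + a powr n)) at_top"
    using assms(1) by (intro tendsto_divide tendsto_add tendsto_const) auto
  moreover have "X powr (m - 1 - n) / (X powr - n + a powr n) = X powr (m - 1) / (1 + (a * X) powr n)"
    if "0 < X" for X
  proof -
    have "X powr (m - 1) = X powr n * X powr (m - 1 - n)"
      by (simp flip: powr_add)
    moreover have "1 + (a * X) powr n = X powr n * (X powr - n + a powr n)"
      using that assms(1) by (simp add: powr_mult distrib_left flip: powr_add)
    ultimately show ?thesis using that by simp
  qed
  then have "\<forall>\<^sub>F X in at_top. X powr (m - 1 - n) / (X powr - n + a powr n)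
      = X powr (m - 1) / (1 + (a * X) powr n)"
    by (rule eventually_mono[OF eventually_gt_at_top])
  ultimately have "((\<lambda>X. X powr (m - 1) / (1 + (a * X) powr n)) \<longlongrightarrow>
      of_bool (m = n + 1) / (0 + a powr n)) at_top"
    by (rule Lim_transform_eventually)
  then show ?thesis by (simp add: powr_minus divide_inverse)
qed

text \<open>The factor \<open>X powr (m - 1)\<close> is the inverse of
  \<open>X powr (1 - m)\<close>, which tends to 0 through positive values, while the rest tends to
  \<open>c > 0\<close>.\<close>

lemma powr_quotient_at_top_at_0:
  fixes c m n :: real
  assumes "0 < c" "0 < n" "m < 1"
  shows "filterlim (\<lambda>X. c * X powr (m - 1) / (1 + X powr n)) at_top (at_right 0)"
proof -
  have pos: "\<forall>\<^sub>F X in at_right 0. 0 < (X :: real)"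
    by (rule eventually_at_right_less)
  have lim: "((\<lambda>X::real. X powr s) \<longlongrightarrow> 0) (at_right 0)" if "0 < s" for s
    using that
    by (intro tendsto_zero_powrI[OF tendsto_ident_at tendsto_const] eventually_mono[OF pos]) auto
  have "((\<lambda>X. c / (1 + X powr n)) \<longlongrightarrow> c / (1 + 0)) (at_right 0)"
    using assms(2) by (intro tendsto_divide tendsto_add tendsto_const lim) auto
  moreover have "filterlim (\<lambda>X. inverse (X powr (1 - m))) at_top (at_right 0)"
    using assms(3) by (intro filterlim_inverse_at_top lim eventually_mono[OF pos]) auto
  ultimately have "filterlim (\<lambda>X. c / (1 + X powr n) * inverse (X powr (1 - m))) at_top (at_right 0)"
    using assms(1) by (intro filterlim_tendsto_pos_mult_at_top) auto
  moreover have "inverse (X powr (1 - m)) = X powr (m - 1)" for X :: real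
    using powr_minus[of X "1 - m"] by simp
  ultimately show ?thesis by simp
qed

section \<open>Periodic functions and weighted sums\<close>

lemma periodic_add_of_int:
  fixes f :: "real \<Rightarrow> 'a"
  assumes "\<And>t. f (t + T) = f t"
  shows "f (t + of_int k * T) = f t"
proof (induction k arbitrary: t rule: int_induct[where k = 0])
  case (step1 i)
  then show ?case using assms[of "t + of_int i * T"] by (simp add: algebra_simps)
next
  case (step2 i)
  then show ?case using assms[of "t + of_int (i - 1) * T"] by (simp add: algebra_simps)
qed simp

text \<open>The codomain is arbitrary so that a pair of periodic functions can be moved to one
  common representative in a chosen period.\<close>

lemma periodic_reduce:
  fixes f :: "real \<Rightarrow> 'a"
  assumes "T > 0" and per: "\<And>t. f (t + T) = f t"
  obtains s where "s \<in> {a..<a + T}" "f s = f t"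
proof -
  define s where "s = t - of_int \<lfloor>(t - a) / T\<rfloor> * T"
  have "s \<in> {a..<a + T}"
    using floor_divide_lower[OF \<open>T > 0\<close>, of "t - a"] floor_divide_upper[OF \<open>T > 0\<close>, of "t - a"]
    by (simp add: s_def algebra_simps)
  moreover have "f s = f t" 
    using periodic_add_of_int[of f T t "- \<lfloor>(t - a) / T\<rfloor>"] per by (simp add: s_def)
  ultimately show ?thesis by (rule that)
qed

lemma periodic_attains_sup:
  fixes f :: "real \<Rightarrow> real"
  assumes "T > 0" "\<And>t. f (t + T) = f t" "continuous_on UNIV f"
  obtains t where "\<And>s. f s \<le> f t"
proof -
  have "\<exists>t\<in>{0..T}. \<forall>s\<in>{0..T}. f s \<le> f t"
    using assms by (intro continuous_attains_sup) (auto intro: continuous_on_subset)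
  then obtain t where t: "\<And>s. s \<in> {0..T} \<Longrightarrow> f s \<le> f t" by blast
  have "f s \<le> f t" for s
    by (rule periodic_reduce[of T f 0 s, OF assms(1,2)]) (use t in force)
  then show ?thesis by (rule that)
qed

lemma periodic_attains_inf:
  fixes f :: "real \<Rightarrow> real"
  assumes "T > 0" "\<And>t. f (t + T) = f t" "continuous_on UNIV f"
  obtains t where "\<And>s. f t \<le> f s"
  using periodic_attains_sup[of T "\<lambda>t. - f t"] assms by (auto intro: continuous_intros)

section \<open>Antiderivatives and Lipschitz bounds on the real line\<close>

text \<open>This is the signed integral from 0 to \<open>t\<close>: for \<open>t\<close> of either
  sign one of the two integrals runs over an empty interval.\<close>

definition antideriv :: "(real \<Rightarrow> real) \<Rightarrow> real \<Rightarrow> real"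
  where "antideriv f t = integral {0..t} f - integral {t..0} f"

lemma antideriv_0 [simp]: "antideriv f 0 = 0"
  by (simp add: antideriv_def)

lemma antideriv_eq_integral: "0 \<le> t \<Longrightarrow> antideriv f t = integral {0..t} f"
  by (cases "t = 0") (auto simp: antideriv_def)

lemma has_real_derivative_antideriv:
  assumes "continuous_on UNIV f"
  shows "(antideriv f has_real_derivative f t) (at t)"
proof -
  define a where "a = \<bar>t\<bar> + 1"
  have int: "f integrable_on {c..d}" for c d
    using assms by (intro integrable_continuous_interval) (auto intro: continuous_on_subset)
  \<comment> \<open>On an open interval around \<open>t\<close> and 0 the signed integral differs
    only by a constant from an integral with fixed left end, to which the fundamental theorem
    applies.\<close>
  have eq: "antideriv f s = integral {-a..s} f - integral {-a..0} f" if "s \<in> {-a<..<a}" for s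
  proof (cases "0 \<le> s")
    case True
    then have "integral {-a..0} f + integral {0..s} f = integral {-a..s} f"
      by (intro Henstock_Kurzweil_Integration.integral_combine int) (auto simp: a_def)
    with True show ?thesis by (simp add: antideriv_eq_integral)
  next
    case False
    then have "integral {-a..s} f + integral {s..0} f = integral {-a..0} f"
      using that by (intro Henstock_Kurzweil_Integration.integral_combine int) auto
    with False show ?thesis by (simp add: antideriv_def)
  qed
  have "((\<lambda>s. integral {-a..s} f) has_real_derivative f t) (at t within {-a..a})"
    using assms by (intro integral_has_real_derivative) (auto simp: a_def intro: continuous_on_subset)
  moreover have "at t within {-a..a} = at t"
    by (rule at_within_Icc_at) (auto simp: a_def)
  ultimately have "((\<lambda>s. integral {-a..s} f - integral {-a..0} f) has_real_derivative f t) (at t)"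
    by (auto intro!: derivative_eq_intros)
  then show ?thesis
    by (rule has_field_derivative_transform_within_open[where S = "{-a<..<a}"])
       (auto simp: eq, auto simp: a_def)
qed

lemma bounded_derivative_imp_lipschitz:
  fixes f :: "real \<Rightarrow> real"
  assumes "convex S" "\<And>t. t \<in> S \<Longrightarrow> (f has_real_derivative f' t) (at t)"
    and "\<And>t. t \<in> S \<Longrightarrow> \<bar>f' t\<bar> \<le> L" "s \<in> S" "t \<in> S"
  shows "\<bar>f s - f t\<bar> \<le> L * \<bar>s - t\<bar>"
  using field_differentiable_bound[OF assms(1) _ _ assms(4,5), of f f' L] assms(2,3)
  by (auto intro: has_field_derivative_at_within)

lemma mono_if_nonneg_derivative:
  fixes f :: "real \<Rightarrow> real"
  assumes "\<And>t. (f has_real_derivative f' t) (at t)" "\<And>t. 0 \<le> f' t"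
  shows "mono f"
  by (rule monoI, rule DERIV_nonneg_imp_nondecreasing) (use assms in blast)+

section \<open>A compact convex set of periodic functions\<close>

text \<open>The type of bounded continuous functions supplies the supremum norm, hence the normed
  space in which Schauder's theorem is applied.\<close>

definition lipschitz_periodic :: "real \<Rightarrow> real \<Rightarrow> real \<Rightarrow> real \<Rightarrow> (real \<Rightarrow>\<^sub>C real) set"
  where "lipschitz_periodic T lo hi L =
    {u :: real \<Rightarrow>\<^sub>C real. (\<forall>t. u (t + T) = u t) \<and> (\<forall>t. u t \<in> {lo..hi}) \<and> (\<forall>s t. \<bar>u s - u t\<bar> \<le> L * \<bar>s - t\<bar>)}"

lemma convex_lipschitz_periodic: "convex (lipschitz_periodic T lo hi L)"
proof (rule convexI)
  fix u v :: "real \<Rightarrow>\<^sub>C real" and c d :: real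
  assume uv: "u \<in> lipschitz_periodic T lo hi L" "v \<in> lipschitz_periodic T lo hi L"
    and cd: "0 \<le> c" "0 \<le> d" "c + d = 1"
  show "c *\<^sub>R u + d *\<^sub>R v \<in> lipschitz_periodic T lo hi L"
    unfolding lipschitz_periodic_def mem_Collect_eq
  proof (intro conjI allI)
    fix s t
    show "(c *\<^sub>R u + d *\<^sub>R v) (t + T) = (c *\<^sub>R u + d *\<^sub>R v) t"
      using uv by (simp add: lipschitz_periodic_def)
    have "c *\<^sub>R u t + d *\<^sub>R v t \<in> {lo..hi}"
      using uv cd by (intro convexD[OF convex_real_interval(5)])
        (auto simp: lipschitz_periodic_def)
    then show "(c *\<^sub>R u + d *\<^sub>R v) t \<in> {lo..hi}" by simp
    have "\<bar>c * (u s - u t) + d * (v s - v t)\<bar> \<le> c * \<bar>u s - u t\<bar> + d * \<bar>v s - v t\<bar>"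
      using cd by (metis abs_mult abs_of_nonneg abs_triangle_ineq)
    also have "\<dots> \<le> c * (L * \<bar>s - t\<bar>) + d * (L * \<bar>s - t\<bar>)"
      using uv cd by (intro add_mono mult_left_mono) (auto simp: lipschitz_periodic_def)
    also have "\<dots> = L * \<bar>s - t\<bar>"
      using cd(3) by (metis distrib_right mult_1)
    finally show "\<bar>(c *\<^sub>R u + d *\<^sub>R v) s - (c *\<^sub>R u + d *\<^sub>R v) t\<bar> \<le> L * \<bar>s - t\<bar>"
      by (simp add: algebra_simps)
  qed
qed

text \<open>Arzela-Ascoli gives a subsequence converging uniformly on one period. Periodicity makes
  it a Cauchy sequence in the supremum norm on the whole line, and all defining conditions pass to
  pointwise limits.\<close>

lemma compact_lipschitz_periodic:
  assumes "T > 0"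
  shows "compact (lipschitz_periodic T lo hi L)"
  unfolding compact_eq_seq_compact_metric seq_compact_def
proof (intro allI impI)
  fix u :: "nat \<Rightarrow> (real \<Rightarrow>\<^sub>C real)"
  assume "\<forall>n. u n \<in> lipschitz_periodic T lo hi L"
  then have per: "\<And>n t. u n (t + T) = u n t" and bnd: "\<And>n t. lo \<le> u n t" "\<And>n t. u n t \<le> hi"
    and lip: "\<And>n s t. \<bar>u n s - u n t\<bar> \<le> L * \<bar>s - t\<bar>"
    by (auto simp: lipschitz_periodic_def)
  obtain g k where k: "strict_mono (k :: nat \<Rightarrow> nat)"
    and lim: "\<And>e. 0 < e \<Longrightarrow> \<exists>N. \<forall>n t. N \<le> n \<and> t \<in> {0..T} \<longrightarrow> norm (u (k n) t - g t) < e"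
  proof (rule Arzela_Ascoli[of "{0..T}" "\<lambda>n. u n" "max \<bar>lo\<bar> \<bar>hi\<bar>"])
    show "norm (u n t) \<le> max \<bar>lo\<bar> \<bar>hi\<bar>" for n t
      using bnd[of n t] by auto
    fix t e :: real assume "0 < e"
    show "\<exists>d>0. \<forall>n s. s \<in> {0..T} \<and> norm (t - s) < d \<longrightarrow> norm (u n t - u n s) < e"
    \<comment> \<open>The denominator \<open>\<bar>L\<bar> + 1\<close> is positive whatever the sign
      of \<open>L\<close>.\<close>
    proof (intro exI[of _ "e / (\<bar>L\<bar> + 1)"] conjI allI impI)
      fix n s assume "s \<in> {0..T} \<and> norm (t - s) < e / (\<bar>L\<bar> + 1)"
      then have "(\<bar>L\<bar> + 1) * \<bar>t - s\<bar> < e" by (simp add: field_simps)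
      moreover have "L * \<bar>t - s\<bar> \<le> (\<bar>L\<bar> + 1) * \<bar>t - s\<bar>" by (intro mult_right_mono) auto
      ultimately show "norm (u n t - u n s) < e" using lip[of n t s] by simp
    qed (use \<open>0 < e\<close> in simp)
  qed auto
  have "Cauchy (u \<circ> k)"
  proof (rule metric_CauchyI)
    fix e :: real assume "0 < e"
    with lim[of "e / 3"] obtain N
      where N: "\<And>n t. N \<le> n \<Longrightarrow> t \<in> {0..T} \<Longrightarrow> \<bar>u (k n) t - g t\<bar> < e / 3" by auto
    \<comment> \<open>The supremum of distances obeys only a weak bound, so \<open>2 * e / 3\<close>
      is aimed at to stay strictly below \<open>e\<close>.\<close>
    have "dist ((u \<circ> k) m) ((u \<circ> k) n) \<le> 2 * e / 3" if mn: "N \<le> m" "N \<le> n" for m n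
    proof (rule dist_bound)
      fix t
      obtain s where s: "s \<in> {0..<0 + T}" "(u (k m) s, u (k n) s) = (u (k m) t, u (k n) t)"
        using periodic_reduce[of T "\<lambda>t. (u (k m) t, u (k n) t)" 0 t] \<open>T > 0\<close> per by auto
      then show "dist ((u \<circ> k) m t) ((u \<circ> k) n t) \<le> 2 * e / 3"
        using N[OF mn(1), of s] N[OF mn(2), of s] dist_triangle2[of "u (k m) s" "u (k n) s" "g s"]
        by (simp add: dist_real_def)
    qed
    then show "\<exists>N. \<forall>m\<ge>N. \<forall>n\<ge>N. dist ((u \<circ> k) m) ((u \<circ> k) n) < e"
      using \<open>0 < e\<close> by (intro exI[of _ N] allI impI) (rule le_less_trans[of _ "2 * e / 3"], auto)
  qed
  then obtain l where l: "(u \<circ> k) \<longlonglongrightarrow> l"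
    using Cauchy_convergent convergent_def by blast
  have pt: "(\<lambda>n. u (k n) t) \<longlonglongrightarrow> l t" for t
    using tendsto_uniform_limitI[OF tendsto_bcontfun_uniform_limit[OF l]] by (simp add: o_def)
  have "l \<in> lipschitz_periodic T lo hi L"
    unfolding lipschitz_periodic_def mem_Collect_eq
  proof (intro conjI allI)
    fix s t
    show "l (t + T) = l t"
      using LIMSEQ_unique[OF pt[of "t + T"]] pt[of t] by (simp add: per)
    show "l t \<in> {lo..hi}"
      using LIMSEQ_le_const[OF pt[of t]] LIMSEQ_le_const2[OF pt[of t]] bnd by auto
    show "\<bar>l s - l t\<bar> \<le> L * \<bar>s - t\<bar>"
      by (rule LIMSEQ_le_const2[OF tendsto_rabs[OF tendsto_diff[OF pt[of s] pt[of t]]]]) (use lip in auto)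
  qed
  with k l show "\<exists>l\<in>lipschitz_periodic T lo hi L. \<exists>r. strict_mono r \<and> (u \<circ> r) \<longlonglongrightarrow> l" by blast
qed

definition periodic_band :: "real \<Rightarrow> real \<Rightarrow> real \<Rightarrow> (real \<Rightarrow> real) set"
  where "periodic_band T lo hi =
    {x. continuous_on UNIV x \<and> (\<forall>t. x (t + T) = x t) \<and> (\<forall>t. x t \<in> {lo..hi})}"

lemma periodic_continuous_lower_bound:
  fixes f :: "real \<Rightarrow> real"
  assumes "T > 0" "continuous_on UNIV f" "\<And>t. f (t + T) = f t" "\<And>t. 0 < f t"
  obtains c where "0 < c" "\<And>t. c \<le> f t"
  using periodic_attains_inf[OF assms(1,3,2)] assms(4) by metis

lemma positive_periodic_coeffD:
  assumes "positive_periodic_coeff T f"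
  shows "continuous_on UNIV f" "f (t + T) = f t" "0 < f t"
  using assms by (auto simp: positive_periodic_coeff_def periodic_fun_simple_def)

lemma positive_periodic_coeff_bounds:
  assumes "positive_periodic_coeff T f" "T > 0"
  obtains c d where "0 < c" "\<And>t. c \<le> f t" "\<And>t. f t \<le> d"
proof -
  note f = positive_periodic_coeffD[OF assms(1)]
  obtain c where "0 < c" "\<And>t. c \<le> f t"
    by (rule periodic_continuous_lower_bound[OF assms(2) f]) blast
  moreover obtain t where "\<And>s. f s \<le> f t"
    using periodic_attains_sup[OF assms(2) f(2,1)] by blast
  ultimately show ?thesis by (rule that)
qed

section \<open>Limits of weighted sums, uniformly in time\<close>

text \<open>Periodic coefficients are bounded by constants \<open>d k\<close>, so the error is
  dominated by a sum that is independent of \<open>t\<close> and tends to 0.\<close>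

lemma eventually_weighted_sum_close:
  fixes g :: "'k \<Rightarrow> real \<Rightarrow> real" and \<psi> :: "'k \<Rightarrow> 'x \<Rightarrow> real"
  assumes "finite K" "T > 0" and g: "\<And>k. k \<in> K \<Longrightarrow> positive_periodic_coeff T (g k)"
    and lim: "\<And>k. k \<in> K \<Longrightarrow> (\<psi> k \<longlongrightarrow> l k) F" and "0 < e"
  shows "\<forall>\<^sub>F X in F. \<forall>t. \<bar>(\<Sum>k\<in>K. g k t * \<psi> k X) - (\<Sum>k\<in>K. g k t * l k)\<bar> < e"
proof -
  have "\<forall>k\<in>K. \<exists>d. \<forall>t. g k t \<le> d"
    using positive_periodic_coeff_bounds[OF g \<open>T > 0\<close>] by metis
  then obtain d where d: "\<And>k t. k \<in> K \<Longrightarrow> g k t \<le> d k" by metis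
  have "((\<lambda>X. \<Sum>k\<in>K. d k * \<bar>\<psi> k X - l k\<bar>) \<longlongrightarrow> (\<Sum>k\<in>K. d k * \<bar>l k - l k\<bar>)) F"
    by (intro tendsto_intros lim)
  then have "\<forall>\<^sub>F X in F. (\<Sum>k\<in>K. d k * \<bar>\<psi> k X - l k\<bar>) < e"
    using \<open>0 < e\<close> by (auto dest: order_tendstoD)
  then show ?thesis
  proof eventually_elim
    case (elim X)
    show ?case
    proof
      fix t
      have "\<bar>(\<Sum>k\<in>K. g k t * \<psi> k X) - (\<Sum>k\<in>K. g k t * l k)\<bar> = \<bar>\<Sum>k\<in>K. g k t * (\<psi> k X - l k)\<bar>"
        by (simp add: right_diff_distrib sum_subtractf)
      also have "\<dots> \<le> (\<Sum>k\<in>K. \<bar>g k t * (\<psi> k X - l k)\<bar>)"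
        by (rule sum_abs)
      also have "\<dots> \<le> (\<Sum>k\<in>K. d k * \<bar>\<psi> k X - l k\<bar>)"
        using d positive_periodic_coeffD(3)[OF g]
        by (intro sum_mono) (simp add: abs_mult less_imp_le mult_right_mono)
      finally show "\<bar>(\<Sum>k\<in>K. g k t * \<psi> k X) - (\<Sum>k\<in>K. g k t * l k)\<bar> < e"
        using elim by linarith
    qed
  qed
qed

text \<open>A continuous periodic function that is positive everywhere has a positive minimum. The
  strict pointwise inequality therefore has a uniform gap \<open>e\<close>, and the uniform
  approximation does not use it up.\<close>

lemma eventually_weighted_sum_le:
  fixes g :: "'k \<Rightarrow> real \<Rightarrow> real" and \<psi> :: "'k \<Rightarrow> 'x \<Rightarrow> real"
  assumes "finite K" "T > 0" and g: "\<And>k. k \<in> K \<Longrightarrow> positive_periodic_coeff T (g k)"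
    and lim: "\<And>k. k \<in> K \<Longrightarrow> (\<psi> k \<longlongrightarrow> l k) F"
    and b: "positive_periodic_coeff T b" and lt: "\<And>t. (\<Sum>k\<in>K. g k t * l k) < b t"
  shows "\<forall>\<^sub>F X in F. \<forall>t. (\<Sum>k\<in>K. g k t * \<psi> k X) \<le> b t"
proof -
  note gD = positive_periodic_coeffD[OF g] and bD = positive_periodic_coeffD[OF b]
  obtain e where "0 < e" "\<And>t. e \<le> b t - (\<Sum>k\<in>K. g k t * l k)"
  proof (rule periodic_continuous_lower_bound[OF \<open>T > 0\<close>])
    show "continuous_on UNIV (\<lambda>t. b t - (\<Sum>k\<in>K. g k t * l k))"
      by (intro continuous_intros gD bD)
    show "b (t + T) - (\<Sum>k\<in>K. g k (t + T) * l k) = b t - (\<Sum>k\<in>K. g k t * l k)" for t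
      by (simp add: gD(2) bD(2))
  qed (use lt in simp, rule that)
  note e = this
  have "\<forall>\<^sub>F X in F. \<forall>t. \<bar>(\<Sum>k\<in>K. g k t * \<psi> k X) - (\<Sum>k\<in>K. g k t * l k)\<bar> < e"
    by (rule eventually_weighted_sum_close[OF assms(1,2) g lim e(1)])
  then show ?thesis
  proof (rule eventually_mono)
    fix X
    assume close: "\<forall>t. \<bar>(\<Sum>k\<in>K. g k t * \<psi> k X) - (\<Sum>k\<in>K. g k t * l k)\<bar> < e"
    show "\<forall>t. (\<Sum>k\<in>K. g k t * \<psi> k X) \<le> b t"
    proof
      fix t
      show "(\<Sum>k\<in>K. g k t * \<psi> k X) \<le> b t"
        using close[rule_format, of t] e(2)[of t] by linarith
    qed
  qed
qed

lemma eventually_weighted_sum_ge: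
  fixes g :: "'k \<Rightarrow> real \<Rightarrow> real" and \<psi> :: "'k \<Rightarrow> 'x \<Rightarrow> real"
  assumes "finite K" "T > 0" and g: "\<And>k. k \<in> K \<Longrightarrow> positive_periodic_coeff T (g k)"
    and lim: "\<And>k. k \<in> K \<Longrightarrow> (\<psi> k \<longlongrightarrow> l k) F"
    and b: "positive_periodic_coeff T b" and gt: "\<And>t. b t < (\<Sum>k\<in>K. g k t * l k)"
  shows "\<forall>\<^sub>F X in F. \<forall>t. b t \<le> (\<Sum>k\<in>K. g k t * \<psi> k X)"
proof -
  note gD = positive_periodic_coeffD[OF g] and bD = positive_periodic_coeffD[OF b]
  obtain e where "0 < e" "\<And>t. e \<le> (\<Sum>k\<in>K. g k t * l k) - b t"
  proof (rule periodic_continuous_lower_bound[OF \<open>T > 0\<close>])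
    show "continuous_on UNIV (\<lambda>t. (\<Sum>k\<in>K. g k t * l k) - b t)"
      by (intro continuous_intros gD bD)
    show "(\<Sum>k\<in>K. g k (t + T) * l k) - b (t + T) = (\<Sum>k\<in>K. g k t * l k) - b t" for t
      by (simp add: gD(2) bD(2))
  qed (use gt in simp, rule that)
  note e = this
  have "\<forall>\<^sub>F X in F. \<forall>t. \<bar>(\<Sum>k\<in>K. g k t * \<psi> k X) - (\<Sum>k\<in>K. g k t * l k)\<bar> < e"
    by (rule eventually_weighted_sum_close[OF assms(1,2) g lim e(1)])
  then show ?thesis
  proof (rule eventually_mono)
    fix X
    assume close: "\<forall>t. \<bar>(\<Sum>k\<in>K. g k t * \<psi> k X) - (\<Sum>k\<in>K. g k t * l k)\<bar> < e"
    show "\<forall>t. b t \<le> (\<Sum>k\<in>K. g k t * \<psi> k X)"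
    proof
      fix t
      show "b t \<le> (\<Sum>k\<in>K. g k t * \<psi> k X)"
        using close[rule_format, of t] e(2)[of t] by linarith
    qed
  qed
qed

lemma powr_quotient_bounds:
  fixes p q lo hi a c :: real
  assumes "0 < lo" "lo \<le> p" "p \<le> hi" "lo \<le> q" "q \<le> hi" "0 < a" "0 < c"
  shows "lo powr a / (1 + hi powr c) \<le> p powr a / (1 + q powr c)"
    and "p powr a / (1 + q powr c) \<le> hi powr a / (1 + lo powr c)"
  using assms by (auto intro!: frac_le powr_mono2 add_pos_nonneg)

text \<open>Turns the limits, which carry indicator factors, into sums over \<open>M2\<close> and
  \<open>M4\<close>.\<close>

lemma sum_mult_of_bool:
  fixes f h :: "'k \<Rightarrow> real"
  assumes "finite K"
  shows "(\<Sum>k\<in>K. f k * (of_bool (P k) * h k)) = (\<Sum>k | k \<in> K \<and> P k. f k * h k)"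
  using assms by (auto simp: sum.inter_filter intro!: sum.cong)

section \<open>Fixed point theorems\<close>

lemma tendsto_fun_iff:
  fixes l :: "'i \<Rightarrow> 'b::topological_space"
  shows "(f \<longlongrightarrow> l) F \<longleftrightarrow> (\<forall>i. ((\<lambda>x. f x i) \<longlongrightarrow> l i) F)"
  using limitin_componentwise[of "\<lambda>_. euclidean" UNIV f l F]
  by (simp add: euclidean_product_topology)

text \<open>Tychonoff's theorem, transferred to the topology of the function type.\<close>

lemma compact_Pi_UNIV:
  fixes A :: "'i \<Rightarrow> 'b::topological_space set"
  assumes "\<And>i. compact (A i)"
  shows "compact (Pi UNIV A)"
  using assms compactin_PiE[of "\<lambda>_. euclidean" UNIV A]
  by (auto simp: euclidean_product_topology PiE_UNIV_domain)

text \<open>Kuhn's lemma labels the grid of mesh \<open>1/p\<close> in the first \<open>p\<close> coordinates. In the limit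
  the corners carrying the two labels of a coordinate merge into a fixed point, so the
  dimension may grow together with \<open>p\<close>.\<close>

theorem brouwer_hilbert_cube:
  fixes f :: "(nat \<Rightarrow> real) \<Rightarrow> nat \<Rightarrow> real"
  defines "Q \<equiv> UNIV \<rightarrow> {0..1}"
  assumes cont: "continuous_on Q f" and into: "f \<in> Q \<rightarrow> Q"
  obtains x where "x \<in> Q" "f x = x"
proof -
  \<comment> \<open>The grid point with integer coordinates \<open>a\<close>, padded by 0 from
    coordinate \<open>p\<close> on so that it lies in the infinite-dimensional cube.\<close>
  define g :: "nat \<Rightarrow> (nat \<Rightarrow> nat) \<Rightarrow> nat \<Rightarrow> real"
    where "g p a = (\<lambda>j. if j < p then real (a j) / real p else 0)" for p a
  \<comment> \<open>Label 0 records that \<open>f\<close> does not decrease coordinate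
    \<open>i\<close>, label 1 that it does not increase it. On the faces \<open>a i = 0\<close> and
    \<open>a i = p\<close> the labels are 0 and 1, as Kuhn's lemma demands; both agree with this
    reading because \<open>f\<close> maps into the cube.\<close>
  define label :: "nat \<Rightarrow> (nat \<Rightarrow> nat) \<Rightarrow> nat \<Rightarrow> nat"
    where "label p a i = (if a i < p \<and> (a i = 0 \<or> g p a i \<le> f (g p a) i) then 0 else 1)" for p a i
  have gQ: "g p a \<in> Q" if "\<forall>j<p. a j \<le> p" for p a
    using that by (auto simp: g_def Q_def divide_le_eq_1)
  have fQ: "0 \<le> f x i" "f x i \<le> 1" if "x \<in> Q" for x i
    using into that by (auto simp: Q_def Pi_iff)
  have lab0: "g p a i \<le> f (g p a) i" if "label p a i = 0" "\<forall>j<p. a j \<le> p" "i < p" for p a i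
    using that fQ(1)[OF gQ[OF that(2)]] by (auto simp: label_def g_def split: if_splits)
  have lab1: "f (g p a) i \<le> g p a i" if "label p a i \<noteq> 0" "\<forall>j<p. a j \<le> p" "i < p" for p a i
  proof (cases "a i = p")
    case True
    then show ?thesis using that fQ(2)[OF gQ[OF that(2)]] by (auto simp: g_def)
  next
    case False
    then have "a i < p" using that by (metis le_neq_implies_less)
    then show ?thesis using that by (auto simp: label_def split: if_splits)
  qed
  have "\<exists>q. (\<forall>i<p. q i < p) \<and> (\<forall>i<p. \<exists>r s. (\<forall>j<p. q j \<le> r j \<and> r j \<le> q j + 1) \<and>
      (\<forall>j<p. q j \<le> s j \<and> s j \<le> q j + 1) \<and> label p r i = 0 \<and> label p s i \<noteq> 0)"
    if p: "0 < p" for p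
  proof -
    obtain q where q: "\<forall>i<p. q i < p"
      "\<forall>i<p. \<exists>r s. (\<forall>j<p. q j \<le> r j \<and> r j \<le> q j + 1) \<and>
        (\<forall>j<p. q j \<le> s j \<and> s j \<le> q j + 1) \<and> label p r i \<noteq> label p s i"
      by (rule kuhn_lemma[OF p, of p "label p"]) (use p in \<open>auto simp: label_def\<close>)
    moreover have "label p a i = 0 \<or> label p a i = 1" for a i by (simp add: label_def)
    ultimately show ?thesis by (metis one_neq_zero)
  qed
  then obtain q where q: "\<And>p i. i < p \<Longrightarrow> q p i < p"
    and "\<forall>p. \<forall>i<p. \<exists>r s. (\<forall>j<p. q p j \<le> r j \<and> r j \<le> q p j + 1) \<and>
      (\<forall>j<p. q p j \<le> s j \<and> s j \<le> q p j + 1) \<and> label p r i = 0 \<and> label p s i \<noteq> 0"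
    by (metis gr_zeroI less_nat_zero_code)
  \<comment> \<open>For each coordinate \<open>i < p\<close> the cell at \<open>q p\<close> has a
    corner \<open>r p i\<close> with label 0 and a corner \<open>s p i\<close> with label 1 in that
    coordinate.\<close>
  then obtain r s where rs: "\<And>p i j. i < p \<Longrightarrow> j < p \<Longrightarrow> q p j \<le> r p i j \<and> r p i j \<le> q p j + 1"
      "\<And>p i j. i < p \<Longrightarrow> j < p \<Longrightarrow> q p j \<le> s p i j \<and> s p i j \<le> q p j + 1"
      "\<And>p i. i < p \<Longrightarrow> label p (r p i) i = 0 \<and> label p (s p i) i \<noteq> 0"
    by metis
  have "compact Q"
    unfolding Q_def by (intro compact_Pi_UNIV compact_Icc)
  moreover have "g p (q p) \<in> Q" for p
    using q by (intro gQ) (auto intro: less_imp_le)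
  ultimately obtain x k where x: "x \<in> Q" and k: "strict_mono k"
    and lim: "((\<lambda>p. g p (q p)) \<circ> k) \<longlonglongrightarrow> x"
    unfolding compact_eq_seq_compact_metric seq_compact_def by metis
  \<comment> \<open>Corners of a cell differ from \<open>q p\<close> by at most \<open>1/p\<close>
    in every coordinate, so every choice of corners has the limit \<open>x\<close>. Control only for
    \<open>i < p\<close> suffices, since \<open>i < k p\<close> holds eventually.\<close>
  have near: "(\<lambda>p. g (k p) (a (k p))) \<longlonglongrightarrow> x"
    if a: "\<And>p j. i < p \<Longrightarrow> j < p \<Longrightarrow> q p j \<le> a p j \<and> a p j \<le> q p j + 1" for a i
    unfolding tendsto_fun_iff
  proof
    fix j
    have "(\<lambda>p. g (k p) (q (k p)) j) \<longlonglongrightarrow> x j"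
      using lim by (simp add: tendsto_fun_iff o_def)
    moreover have "(\<lambda>p. g (k p) (a (k p)) j - g (k p) (q (k p)) j) \<longlonglongrightarrow> 0"
    proof (rule tendsto_rabs_zero_cancel, rule tendsto_sandwich[of "\<lambda>_. 0" _ _ "\<lambda>p. 1 / real (k p)"])
      have "\<bar>g p (a p) j - g p (q p) j\<bar> \<le> 1 / real p" if "i < p" for p
        using a[of p j] that by (auto simp: g_def field_simps simp flip: of_nat_diff of_nat_Suc)
      moreover have "\<forall>\<^sub>F p in sequentially. i < k p"
        by (rule eventually_compose_filterlim[OF eventually_gt_at_top filterlim_subseq[OF k]])
      ultimately show "\<forall>\<^sub>F p in sequentially. \<bar>g (k p) (a (k p)) j - g (k p) (q (k p)) j\<bar> \<le> 1 / real (k p)"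
        by (auto elim: eventually_mono)
      show "(\<lambda>p. 1 / real (k p)) \<longlonglongrightarrow> 0"
        using LIMSEQ_subseq_LIMSEQ[OF lim_1_over_n k] by (simp add: o_def)
    qed auto
    ultimately show "(\<lambda>p. g (k p) (a (k p)) j) \<longlonglongrightarrow> x j"
      using tendsto_add by fastforce
  qed
  have "f x i = x i" for i
  proof (rule antisym)
    have ev: "\<forall>\<^sub>F p in sequentially. i < k p"
      by (rule eventually_compose_filterlim[OF eventually_gt_at_top filterlim_subseq[OF k]])
    \<comment> \<open>Since \<open>q p j < p\<close>, a step of 1 does not leave the grid.\<close>
    have le: "\<forall>j<p. a p j \<le> p"
      if "\<And>j. j < p \<Longrightarrow> q p j \<le> a p j \<and> a p j \<le> q p j + 1" for p a
      using that q by (metis Suc_eq_plus1 Suc_leI le_trans)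
    have lims: "(\<lambda>p. g (k p) (a (k p)) i) \<longlonglongrightarrow> x i" "(\<lambda>p. f (g (k p) (a (k p))) i) \<longlonglongrightarrow> f x i"
      if a: "\<And>p j. i < p \<Longrightarrow> j < p \<Longrightarrow> q p j \<le> a p j \<and> a p j \<le> q p j + 1" for a
    proof -
      show "(\<lambda>p. g (k p) (a (k p)) i) \<longlonglongrightarrow> x i"
        using near[OF a] by (simp add: tendsto_fun_iff)
      have "\<forall>\<^sub>F p in sequentially. g (k p) (a (k p)) \<in> Q"
        using ev
      proof eventually_elim
        case (elim p)
        show ?case by (intro gQ le a elim)
      qed
      from continuous_on_tendsto_compose[OF cont near[OF a] x this]
      show "(\<lambda>p. f (g (k p) (a (k p))) i) \<longlonglongrightarrow> f x i"
        by (simp add: tendsto_fun_iff)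
    qed
    have rlims: "(\<lambda>p. g (k p) (r (k p) i) i) \<longlonglongrightarrow> x i" "(\<lambda>p. f (g (k p) (r (k p) i)) i) \<longlonglongrightarrow> f x i"
      by (rule lims[of "\<lambda>p. r p i"], use rs(1) in blast)+
    have slims: "(\<lambda>p. g (k p) (s (k p) i) i) \<longlonglongrightarrow> x i" "(\<lambda>p. f (g (k p) (s (k p) i)) i) \<longlonglongrightarrow> f x i"
      by (rule lims[of "\<lambda>p. s p i"], use rs(2) in blast)+
    have "\<forall>\<^sub>F p in sequentially. g (k p) (r (k p) i) i \<le> f (g (k p) (r (k p) i)) i"
      using ev
    proof eventually_elim
      case (elim p)
      with rs(1,3) show ?case by (intro lab0 le[of _ "\<lambda>p. r p i"]) auto
    qed
    then show "x i \<le> f x i"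
      by (rule tendsto_le[OF sequentially_bot rlims(2,1)])
    have "\<forall>\<^sub>F p in sequentially. f (g (k p) (s (k p) i)) i \<le> g (k p) (s (k p) i) i"
      using ev
    proof eventually_elim
      case (elim p)
      with rs(2,3) show ?case by (intro lab1 le[of _ "\<lambda>p. s p i"]) auto
    qed
    then show "f x i \<le> x i"
      by (rule tendsto_le[OF sequentially_bot slims])
  qed
  with x that show ?thesis by blast
qed

section \<open>Schauder's fixed point theorem\<close>

text \<open>Schauder projection: points are replaced by convex combinations of a finite
  \<open>e\<close>-net, and Brouwer's theorem is applied to the weights. As the weights vary in a
  cube rather than a simplex, they are normalised first.\<close>

lemma schauder_approximation:
  fixes f :: "'a::real_normed_vector \<Rightarrow> 'a"
  assumes "compact S" "convex S" "S \<noteq> {}" and cont: "continuous_on S f" and into: "f \<in> S \<rightarrow> S"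
    and "0 < e"
  obtains x where "x \<in> S" "dist x (f x) \<le> e"
proof -
  have "seq_compact S"
    using \<open>compact S\<close> by (simp only: compact_eq_seq_compact_metric)
  then obtain K where K: "finite K" "K \<subseteq> S" "S \<subseteq> (\<Union>x\<in>K. ball x e)"
    using seq_compact_imp_totally_bounded \<open>0 < e\<close> by metis
  obtain n :: nat and p :: "nat \<Rightarrow> 'a" where p: "K = p ` {i. i < n}"
    using finite_imp_nat_seg_image_inj_on[OF K(1)] by auto
  have pS: "p i \<in> S" if "i < n" for i using p K(2) that by auto
  have "n > 0" using p K(3) \<open>S \<noteq> {}\<close> by (cases n) auto
  \<comment> \<open>Tent functions, positive only within distance \<open>e\<close> of a net point;
    dividing by their sum gives the partition of unity \<open>w\<close>.\<close>
  define \<phi> where "\<phi> i y = max 0 (e - dist (p i) y)" for i y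
  define w where "w y i = (if i < n then \<phi> i y / (\<Sum>j<n. \<phi> j y) else 0)" for y i
  \<comment> \<open>Makes any point of the cube a system of convex weights: a total below 1 is
    filled up in coordinate 0, a total above 1 is scaled down, and a total of exactly 1 is left
    alone.\<close>
  define c where "c z i = (z i + of_bool (i = 0) * (1 - min 1 (\<Sum>j<n. z j))) / max 1 (\<Sum>j<n. z j)"
    for z :: "nat \<Rightarrow> real" and i
  define q where "q z = (\<Sum>i<n. c z i *\<^sub>R p i)" for z
  let ?Q = "UNIV \<rightarrow> {0..1::real} :: (nat \<Rightarrow> real) set"
  have \<phi>pos: "0 < (\<Sum>j<n. \<phi> j y)" if "y \<in> S" for y
  proof -
    from K(3) p that obtain i where "i < n" "dist (p i) y < e" by auto
    then show ?thesis by (intro sum_pos2[of _ i]) (auto simp: \<phi>_def)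
  qed
  have wsum: "(\<Sum>i<n. w y i) = 1" if "y \<in> S" for y
    using \<phi>pos[OF that] by (simp add: w_def flip: sum_divide_distrib)
  have w0: "0 \<le> w y i" for y i
    by (auto simp: w_def \<phi>_def intro!: divide_nonneg_nonneg sum_nonneg)
  have w1: "w y i \<le> 1" if "y \<in> S" for y i
  proof (cases "i < n")
    case True
    then show ?thesis
      using member_le_sum[of i "{..<n}" "w y"] w0 wsum[OF that] by simp
  qed (simp add: w_def)
  have csum: "(\<Sum>i<n. c z i) = 1" for z
  proof -
    have "(\<Sum>i<n. z i + of_bool (i = 0) * (1 - min 1 (\<Sum>j<n. z j))) = max 1 (\<Sum>j<n. z j)"
      using \<open>n > 0\<close> by (simp add: sum.distrib of_bool_def flip: sum_distrib_right)
    then show ?thesis by (simp add: c_def flip: sum_divide_distrib)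
  qed
  have qS: "q z \<in> S" if "z \<in> ?Q" for z
    unfolding q_def
  proof (rule convex_sum[OF _ \<open>convex S\<close> csum])
    show "0 \<le> c z i" for i
      using that by (auto simp: c_def Pi_iff intro!: divide_nonneg_pos add_nonneg_nonneg)
  qed (use pS in auto)
  have fqS: "f (q z) \<in> S" if "z \<in> ?Q" for z
    using qS[OF that] into by auto
  have "continuous_on ?Q (\<lambda>z. z i)" for i
    by (rule continuous_on_product_then_coordinatewise[OF continuous_on_id])
  then have cont_q: "continuous_on ?Q q"
    unfolding q_def c_def by (intro continuous_intros) auto
  have cont_w: "continuous_on S (\<lambda>y. w y i)" for i
    using \<phi>pos by (cases "i < n") (auto simp: w_def \<phi>_def intro!: continuous_intros less_imp_neq[symmetric])
  have "continuous_on ?Q (\<lambda>z. w (f (q z)))"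
    by (intro continuous_on_coordinatewise_then_product
        continuous_on_compose2[OF cont_w continuous_on_compose2[OF cont cont_q]])
       (use qS fqS in auto)
  moreover have "(\<lambda>z. w (f (q z))) \<in> ?Q \<rightarrow> ?Q"
    using w0 w1 fqS by auto
  ultimately obtain z where z: "z \<in> ?Q" "w (f (q z)) = z"
    by (rule brouwer_hilbert_cube)
  define y where "y = f (q z)"
  have y: "y \<in> S" "w y = z" using z fqS by (auto simp: y_def)
  \<comment> \<open>At the fixed point the weights already have sum 1, so the normalisation is the
    identity and \<open>q z\<close> is the Schauder projection of \<open>y\<close>.\<close>
  have "c z i = z i" for i
    using wsum[OF y(1)] by (simp add: c_def y(2))
  then have "q z = (\<Sum>i<n. w y i *\<^sub>R p i)"
    by (simp add: q_def y(2))
  moreover have "(\<Sum>i<n. w y i *\<^sub>R p i) \<in> cball y e"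
  proof -
    \<comment> \<open>Net points of weight 0 may be far from \<open>y\<close>; replacing them by
      \<open>y\<close> does not alter the sum and puts all points into the convex ball.\<close>
    have "(\<Sum>i<n. w y i *\<^sub>R (if w y i = 0 then y else p i)) \<in> cball y e"
    proof (rule convex_sum[OF _ convex_cball wsum[OF y(1)] w0])
      show "(if w y i = 0 then y else p i) \<in> cball y e" for i
        using \<open>0 < e\<close> by (auto simp: w_def \<phi>_def dist_commute max_def split: if_splits)
    qed auto
    also have "(\<Sum>i<n. w y i *\<^sub>R (if w y i = 0 then y else p i)) = (\<Sum>i<n. w y i *\<^sub>R p i)"
      by (intro sum.cong) auto
    finally show ?thesis .
  qed
  ultimately have "dist (q z) (f (q z)) \<le> e"
    by (simp add: y_def dist_commute)
  with qS z that show ?thesis by blast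
qed

text \<open>By compactness the displacement \<open>dist x (f x)\<close> attains its minimum, which
  lies below every \<open>e > 0\<close> by the approximate version.\<close>

theorem schauder:
  fixes f :: "'a::real_normed_vector \<Rightarrow> 'a"
  assumes "compact S" "convex S" "S \<noteq> {}" and cont: "continuous_on S f" and into: "f \<in> S \<rightarrow> S"
  obtains x where "x \<in> S" "f x = x"
proof -
  have "continuous_on S (\<lambda>x. dist x (f x))"
    by (intro continuous_intros cont)
  then obtain x where x: "x \<in> S" "\<And>y. y \<in> S \<Longrightarrow> dist x (f x) \<le> dist y (f y)"
    using continuous_attains_inf[OF assms(1,3)] by blast
  have "dist x (f x) \<le> e" if "0 < e" for e
    using schauder_approximation[OF assms that] x(2) by (metis order_trans)
  then have "dist x (f x) \<le> 0"
    by (rule field_le_epsilon[where y = 0, simplified])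
  with x that show ?thesis by auto
qed

section \<open>Periodic solutions of feedback equations\<close>

text \<open>The right-hand side is an abstract operator \<open>\<Phi>\<close>, controlled only on
  bands of periodic functions that stay away from 0. The function \<open>B\<close> is the
  antiderivative of \<open>b\<close> with \<open>B 0 = 0\<close>.\<close>

context
  fixes T C :: real and b B :: "real \<Rightarrow> real" and \<Phi> :: "(real \<Rightarrow> real) \<Rightarrow> real \<Rightarrow> real"
  assumes T_pos: "T > 0"
    and b: "positive_periodic_coeff T b"
    and B_deriv: "\<And>t. (B has_real_derivative b t) (at t)" and B_0 [simp]: "B 0 = 0" and B_T [simp]: "B T = C"
    and feedback_cont: "\<And>lo hi x. 0 < lo \<Longrightarrow> x \<in> periodic_band T lo hi \<Longrightarrow> continuous_on UNIV (\<Phi> x)"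
    and feedback_periodic: "\<And>lo hi x t. 0 < lo \<Longrightarrow> x \<in> periodic_band T lo hi \<Longrightarrow> \<Phi> x (t + T) = \<Phi> x t"
    and feedback_bounds: "\<And>lo hi. 0 < lo \<Longrightarrow>
      \<exists>c d. 0 < c \<and> (\<forall>x\<in>periodic_band T lo hi. \<forall>t. \<Phi> x t \<in> {c..d})"
    and feedback_unif: "\<And>lo hi e. 0 < lo \<Longrightarrow> 0 < e \<Longrightarrow>
      \<exists>d>0. \<forall>x\<in>periodic_band T lo hi. \<forall>y\<in>periodic_band T lo hi.
        (\<forall>t. \<bar>x t - y t\<bar> < d) \<longrightarrow> (\<forall>t. \<bar>\<Phi> x t - \<Phi> y t\<bar> < e)"
begin

section \<open>The periodic solution of the linear equation\<close>

text \<open>With the integrating factor, \<open>y * exp B\<close> has derivative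
  \<open>exp B * \<Phi> x\<close>, so \<open>W x\<close> is its increment from 0. Periodicity then
  reads \<open>exp C * y 0 = y 0 + W x T\<close>, which determines the value of \<open>y 0\<close>
  named \<open>\<rho> x\<close> below.\<close>

definition W where "W x = antideriv (\<lambda>t. exp (B t) * \<Phi> x t)"

text \<open>For given \<open>x\<close>, the \<open>T\<close>-periodic solution of \<open>y' = \<Phi> x - b y\<close> is \<open>\<rho> x\<close> times \<open>V x\<close>, where
  \<open>V x 0 = 1\<close>.\<close>

definition \<rho> where "\<rho> x = W x T / (exp C - 1)"
definition V where "V x t = exp (- B t) * (1 + W x t / \<rho> x)"

lemma b_cont: "continuous_on UNIV b" and b_pos: "0 < b t" and b_periodic: "b (t + T) = b t"
  using b by (auto simp: positive_periodic_coeff_def periodic_fun_simple_def)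

lemma B_mono: "mono B"
  by (rule mono_if_nonneg_derivative[OF B_deriv]) (simp add: b_pos less_imp_le)

lemma B_add_period: "B (t + T) = B t + C"
proof -
  have "((\<lambda>t. B (t + T)) has_real_derivative b (t + T)) (at t)" for t
    using B_deriv DERIV_shift by blast
  then have "((\<lambda>t. B (t + T) - B t) has_real_derivative 0) (at t)" for t
    by (auto intro!: derivative_eq_intros B_deriv simp: b_periodic)
  then show ?thesis
    using DERIV_isconst_all[of "\<lambda>t. B (t + T) - B t" t 0] by simp
qed

lemma C_pos: "0 < C"
  using DERIV_pos_imp_increasing[of 0 T B] T_pos B_deriv b_pos by fastforce

lemma exp_C: "1 < exp C"
  using C_pos by simp

lemma B_Icc: "t \<in> {0..T} \<Longrightarrow> B t \<in> {0..C}"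
  using monoD[OF B_mono, of 0 t] monoD[OF B_mono, of t T] by simp

context
  fixes lo hi :: real and x :: "real \<Rightarrow> real"
  assumes lo: "0 < lo" and x: "x \<in> periodic_band T lo hi"
begin

lemma feedback_lower_bound:
  obtains c where "0 < c" "\<And>t. c \<le> \<Phi> x t"
  using feedback_bounds[OF lo, of hi] x by (meson atLeastAtMost_iff)

lemma feedback_pos: "0 < \<Phi> x t"
  using feedback_lower_bound less_le_trans by metis

lemma W_deriv: "(W x has_real_derivative exp (B t) * \<Phi> x t) (at t)"
proof -
  have "continuous_on UNIV B"
    by (rule DERIV_continuous_on[OF has_field_derivative_at_within[OF B_deriv]])
  then show ?thesis
    unfolding W_def by (intro has_real_derivative_antideriv continuous_intros feedback_cont[OF lo x])
qed

lemma W_0: "W x 0 = 0"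
  by (simp add: W_def)

lemma W_mono: "mono (W x)"
  by (rule mono_if_nonneg_derivative[OF W_deriv]) (simp add: feedback_pos less_imp_le)

lemma W_add_period: "W x (t + T) = W x T + exp C * W x t"
proof -
  have "((\<lambda>t. W x (t + T)) has_real_derivative exp (B (t + T)) * \<Phi> x (t + T)) (at t)" for t
    using W_deriv DERIV_shift by blast
  then have "((\<lambda>t. W x (t + T) - exp C * W x t) has_real_derivative 0) (at t)" for t
    by (auto intro!: derivative_eq_intros W_deriv
        simp: B_add_period exp_add feedback_periodic[OF lo x])
  then show ?thesis
    using DERIV_isconst_all[of "\<lambda>t. W x (t + T) - exp C * W x t" t 0] by (simp add: W_0)
qed

lemma W_ge:
  assumes "\<And>t. c \<le> \<Phi> x t" "0 \<le> c"
  shows "c * T \<le> W x T"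
proof -
  have "W x 0 - c * 0 \<le> W x T - c * T"
  proof (rule DERIV_nonneg_imp_nondecreasing[of 0 T "\<lambda>t. W x t - c * t"])
    fix t assume t: "0 \<le> t" "t \<le> T"
    have "1 * c \<le> exp (B t) * \<Phi> x t"
      using assms B_Icc[of t] t by (intro mult_mono) auto
    moreover have "((\<lambda>t. W x t - c * t) has_real_derivative exp (B t) * \<Phi> x t - c) (at t)"
      by (auto intro!: derivative_eq_intros W_deriv)
    ultimately show "\<exists>y. ((\<lambda>t. W x t - c * t) has_real_derivative y) (at t) \<and> 0 \<le> y"
      by auto
  qed (use T_pos in simp)
  then show ?thesis by (simp add: W_0)
qed

text \<open>The bound depends on \<open>x\<close> only through the lower bound \<open>c\<close>, so
  it is uniform over a band and gives a common Lipschitz constant for all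
  \<open>V x\<close>.\<close>

lemma \<rho>_ge: "(\<And>t. c \<le> \<Phi> x t) \<Longrightarrow> 0 \<le> c \<Longrightarrow> c * T / (exp C - 1) \<le> \<rho> x"
  using W_ge[of c] exp_C by (simp add: \<rho>_def divide_right_mono)

lemma \<rho>_pos: "0 < \<rho> x"
proof -
  obtain c where "0 < c" "\<And>t. c \<le> \<Phi> x t"
    using feedback_lower_bound by blast
  moreover from this have "0 < c * T / (exp C - 1)" using T_pos C_pos by simp
  ultimately show ?thesis using \<rho>_ge[of c] by force
qed

lemma W_period: "W x T / \<rho> x = exp C - 1"
proof -
  have "W x T \<noteq> 0" using \<rho>_pos by (auto simp: \<rho>_def)
  then show ?thesis by (simp add: \<rho>_def)
qed

lemma V_0: "V x 0 = 1"
  by (simp add: V_def W_0)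

lemma V_deriv: "(V x has_real_derivative \<Phi> x t / \<rho> x - b t * V x t) (at t)"
proof (rule DERIV_cong)
  show "(V x has_real_derivative
      exp (- B t) * (- b t) * (1 + W x t / \<rho> x) + exp (- B t) * (exp (B t) * \<Phi> x t / \<rho> x)) (at t)"
    unfolding V_def[abs_def] using \<rho>_pos by (auto intro!: derivative_eq_intros B_deriv W_deriv)
  have "exp (- B t) * (exp (B t) * \<Phi> x t / \<rho> x) = \<Phi> x t / \<rho> x"
    by (simp add: exp_minus)
  moreover have "exp (- B t) * (- b t) * (1 + W x t / \<rho> x) = - (b t * V x t)"
    by (simp add: V_def)
  ultimately show "exp (- B t) * (- b t) * (1 + W x t / \<rho> x) + exp (- B t) * (exp (B t) * \<Phi> x t / \<rho> x)
      = \<Phi> x t / \<rho> x - b t * V x t"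
    by linarith
qed

lemma V_cont: "continuous_on UNIV (V x)"
  by (rule DERIV_continuous_on[OF has_field_derivative_at_within[OF V_deriv]])

lemma V_periodic: "V x (t + T) = V x t"
proof -
  \<comment> \<open>The value of \<open>\<rho> x\<close> is exactly what makes this factor grow by
    \<open>exp C\<close> per period, which cancels the decay of \<open>exp (- B t)\<close>.\<close>
  have "1 + W x (t + T) / \<rho> x = exp C * (1 + W x t / \<rho> x)"
    using W_period by (subst W_add_period) (simp add: add_divide_distrib algebra_simps)
  moreover have "exp (- B (t + T)) * exp C = exp (- B t)"
    by (simp add: B_add_period flip: exp_add)
  ultimately show ?thesis
    by (simp add: V_def flip: mult.assoc)
qed

text \<open>For negative arguments \<open>W x\<close> is not positive, so the point is first moved
  into the period starting at 0.\<close>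

lemma V_pos: "0 < V x t"
proof -
  obtain s where s: "s \<in> {0..<0 + T}" "V x s = V x t"
    by (rule periodic_reduce[of T "V x" 0 t, OF T_pos V_periodic])
  then have "0 \<le> W x s"
    using monoD[OF W_mono, of 0 s] by (simp add: W_0)
  then have "0 < V x s"
    using \<rho>_pos by (simp add: V_def add_pos_nonneg)
  with s show ?thesis by simp
qed

text \<open>The function \<open>exp B * V x\<close> equals \<open>1 + W x / \<rho> x\<close> and is
  nondecreasing. Moving \<open>s\<close> into the period that starts at \<open>t\<close> lets
  \<open>B\<close> grow by at most \<open>C\<close>, which is the only loss.\<close>

lemma V_harnack: "exp (- C) * V x t \<le> V x s"
proof -
  obtain s' where s': "s' \<in> {t..<t + T}" "V x s' = V x s"
    by (rule periodic_reduce[of T "V x" t s, OF T_pos V_periodic])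
  have "exp (- C) * V x t \<le> exp (B t - B s') * V x t"
    using monoD[OF B_mono, of s' "t + T"] s' V_pos[of t] by (intro mult_right_mono) (auto simp: B_add_period)
  also have "\<dots> = exp (- B s') * (1 + W x t / \<rho> x)"
    by (simp add: V_def flip: mult.assoc exp_add)
  also have "\<dots> \<le> V x s'"
    using monoD[OF W_mono, of t s'] s'(1) \<rho>_pos by (simp add: V_def divide_right_mono)
  finally show ?thesis by (simp only: s'(2))
qed

text \<open>The Harnack inequality is used in both directions against the normalisation
  \<open>V x 0 = 1\<close>.\<close>

lemma V_Icc: "V x t \<in> {exp (- C)..exp C}"
proof -
  have "V x t = exp C * (exp (- C) * V x t)"
    by (simp flip: mult.assoc exp_add)
  also have "\<dots> \<le> exp C * 1"
    using V_harnack[of t 0] by (intro mult_left_mono) (auto simp: V_0)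
  finally show ?thesis
    using V_harnack[of 0 t] by (simp add: V_0)
qed

end

text \<open>Continuous dependence on \<open>\<Phi>\<close>. The constants involve
  \<open>\<rho> y\<close> but not \<open>\<rho> x\<close>, so they are fixed while \<open>x\<close>
  approaches \<open>y\<close>.\<close>

lemma V_close:
  assumes "0 < lo" "x \<in> periodic_band T lo hi" "y \<in> periodic_band T lo hi"
    and close: "\<And>t. \<bar>\<Phi> x t - \<Phi> y t\<bar> \<le> e"
  shows "\<bar>\<rho> x - \<rho> y\<bar> \<le> exp C * T / (exp C - 1) * e"
    and "\<bar>V x t - V y t\<bar> \<le> 2 * exp C * T / \<rho> y * e"
proof -
  note x = assms(1,2) and y = assms(1,3)
  have W: "\<bar>W x t - W y t\<bar> \<le> exp C * T * e" if t: "t \<in> {0..T}" for t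
  proof -
    have "\<bar>(W x t - W y t) - (W x 0 - W y 0)\<bar> \<le> exp C * e * \<bar>t - 0\<bar>"
    proof (rule bounded_derivative_imp_lipschitz[OF convex_real_interval(5)])
      fix s assume s: "s \<in> {0..T}"
      show "((\<lambda>t. W x t - W y t) has_real_derivative exp (B s) * (\<Phi> x s - \<Phi> y s)) (at s)"
        by (auto intro!: derivative_eq_intros W_deriv[OF x] W_deriv[OF y] simp: algebra_simps)
      show "\<bar>exp (B s) * (\<Phi> x s - \<Phi> y s)\<bar> \<le> exp C * e"
        using B_Icc[OF s] close[of s] by (simp add: abs_mult mult_mono)
    qed (use t T_pos in auto)
    also have "\<dots> \<le> exp C * e * T"
      using t close[of 0] by (intro mult_left_mono) auto
    finally show ?thesis by (simp add: W_0[OF x] W_0[OF y] mult_ac)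
  qed
  show \<rho>: "\<bar>\<rho> x - \<rho> y\<bar> \<le> exp C * T / (exp C - 1) * e"
    using W[of T] T_pos exp_C by (simp add: \<rho>_def divide_right_mono flip: diff_divide_distrib)
  obtain s where s: "s \<in> {0..<0 + T}" "(V x s, V y s) = (V x t, V y t)"
    by (rule periodic_reduce[of T "\<lambda>t. (V x t, V y t)" 0 t])
       (use T_pos V_periodic[OF x] V_periodic[OF y] in auto)
  have WT: "0 \<le> W x s" "W x s / \<rho> x \<le> exp C - 1"
  proof -
    show "0 \<le> W x s" using monoD[OF W_mono[OF x], of 0 s] s by (simp add: W_0[OF x])
    have "W x s / \<rho> x \<le> W x T / \<rho> x"
      using monoD[OF W_mono[OF x], of s T] s \<rho>_pos[OF x] by (simp add: divide_right_mono)
    also have "\<dots> = exp C - 1" by (rule W_period[OF x])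
    finally show "W x s / \<rho> x \<le> exp C - 1" .
  qed
  \<comment> \<open>Separates the change of the numerator from that of the denominator. The
    coefficient \<open>a / p\<close> becomes \<open>W x s / \<rho> x\<close>, at most
    \<open>exp C - 1\<close>, which cancels the denominator in the estimate for
    \<open>\<rho>\<close>.\<close>
  have split: "a / p - a' / q = (a - a') / q + a / p * ((q - p) / q)"
    if "p \<noteq> 0" "q \<noteq> 0" for a a' p q :: real
    using that by (simp add: field_simps)
  have "\<bar>W x s / \<rho> x - W y s / \<rho> y\<bar>
      = \<bar>(W x s - W y s) / \<rho> y + W x s / \<rho> x * ((\<rho> y - \<rho> x) / \<rho> y)\<bar>"
    using split[of "\<rho> x" "\<rho> y"] \<rho>_pos[OF x] \<rho>_pos[OF y] by simp
  also have "\<dots> \<le> \<bar>(W x s - W y s) / \<rho> y\<bar> + W x s / \<rho> x * (\<bar>\<rho> y - \<rho> x\<bar> / \<rho> y)"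
    using \<rho>_pos[OF x] \<rho>_pos[OF y] WT by (intro order_trans[OF abs_triangle_ineq]) (simp add: abs_mult)
  also have "\<dots> \<le> exp C * T * e / \<rho> y + (exp C - 1) * ((exp C * T / (exp C - 1) * e) / \<rho> y)"
  proof (intro add_mono)
    show "\<bar>(W x s - W y s) / \<rho> y\<bar> \<le> exp C * T * e / \<rho> y"
      unfolding abs_divide abs_of_pos[OF \<rho>_pos[OF y]]
      by (intro divide_right_mono W less_imp_le[OF \<rho>_pos[OF y]]) (use s in simp)
    have "\<bar>\<rho> y - \<rho> x\<bar> / \<rho> y \<le> exp C * T / (exp C - 1) * e / \<rho> y"
      using \<rho> unfolding abs_minus_commute[of "\<rho> y"]
      by (intro divide_right_mono less_imp_le[OF \<rho>_pos[OF y]])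
    then show "W x s / \<rho> x * (\<bar>\<rho> y - \<rho> x\<bar> / \<rho> y)
        \<le> (exp C - 1) * ((exp C * T / (exp C - 1) * e) / \<rho> y)"
      using exp_C by (intro mult_mono[OF WT(2)] divide_nonneg_pos \<rho>_pos[OF y]) auto
  qed
  also have "\<dots> = 2 * exp C * T / \<rho> y * e"
    using C_pos by simp
  finally have *: "\<bar>W x s / \<rho> x - W y s / \<rho> y\<bar> \<le> 2 * exp C * T / \<rho> y * e" .
  have "\<bar>V x s - V y s\<bar> = exp (- B s) * \<bar>W x s / \<rho> x - W y s / \<rho> y\<bar>"
    by (simp add: V_def abs_mult flip: right_diff_distrib)
  also have "\<dots> \<le> 1 * \<bar>W x s / \<rho> x - W y s / \<rho> y\<bar>"
    using B_Icc[of s] s by (intro mult_right_mono) auto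
  finally show "\<bar>V x t - V y t\<bar> \<le> 2 * exp C * T / \<rho> y * e" using * s by simp
qed

section \<open>Existence by a fixed point for shape and amplitude\<close>

text \<open>In \<open>small\<close> and \<open>large\<close> the time \<open>t\<close> is a maximum
  point of \<open>x\<close> with value \<open>X\<close>, and the lower edge of the band is the one
  guaranteed by the Harnack inequality.\<close>

theorem positive_periodic_solution_exists:
  fixes \<sigma> \<delta> R :: real
  assumes \<sigma>: "\<bar>\<sigma>\<bar> = 1" and "0 < \<delta>"
    and small: "\<And>x t X. 0 < X \<Longrightarrow> X \<le> \<delta> \<Longrightarrow> x \<in> periodic_band T (exp (- C) * X) X \<Longrightarrow> x t = X \<Longrightarrow>
      0 \<le> \<sigma> * (\<Phi> x t - b t * X)"
    and large: "\<And>x t X. 0 < X \<Longrightarrow> R \<le> X \<Longrightarrow> x \<in> periodic_band T (exp (- C) * X) X \<Longrightarrow> x t = X \<Longrightarrow>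
      \<sigma> * (\<Phi> x t - b t * X) \<le> 0"
  obtains x where "\<And>t. 0 < x t" "\<And>t. x (t + T) = x t"
    "\<And>t. (x has_real_derivative \<Phi> x t - b t * x t) (at t)"
proof -
  \<comment> \<open>If \<open>r = \<alpha>\<close>, then \<open>x = r * V x\<close> is at most
    \<open>\<alpha> * exp C = \<delta>\<close>, so \<open>small\<close> applies; if
    \<open>r = \<beta>\<close>, then \<open>X \<ge> x 0 = \<beta> \<ge> R\<close>, so
    \<open>large\<close> applies.\<close>
  define \<alpha> where "\<alpha> = \<delta> * exp (- C)"
  define \<beta> where "\<beta> = max \<alpha> R"
  have ab: "0 < \<alpha>" "\<alpha> \<le> \<beta>" "R \<le> \<beta>"
    using \<open>0 < \<delta>\<close> by (auto simp: \<alpha>_def \<beta>_def)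
  define lo where "lo = \<alpha> * exp (- C)"
  define hi where "hi = \<beta> * exp C"
  have lo: "0 < lo" using ab by (simp add: lo_def)
  obtain c d where c: "0 < c" and cd: "\<And>x t. x \<in> periodic_band T lo hi \<Longrightarrow> \<Phi> x t \<in> {c..d}"
    using feedback_bounds[OF lo] by meson
  obtain tb where tb: "\<And>t. b t \<le> b tb"
    using periodic_attains_sup[OF T_pos b_periodic b_cont] by blast
  define \<rho>0 where "\<rho>0 = c * T / (exp C - 1)"
  have \<rho>0: "0 < \<rho>0" using c T_pos C_pos by (simp add: \<rho>0_def)
  have \<rho>0_le: "\<rho>0 \<le> \<rho> x" if "x \<in> periodic_band T lo hi" for x
    unfolding \<rho>0_def using cd[OF that] c by (intro \<rho>_ge[OF lo that]) auto
  \<comment> \<open>Bounds the derivative \<open>\<Phi> x / \<rho> x - b * V x\<close> on the band,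
    using \<open>\<rho>0 \<le> \<rho> x\<close> and \<open>V x \<le> exp C\<close>.\<close>
  define L where "L = d / \<rho>0 + b tb * exp C"
  define D where "D = lipschitz_periodic T (exp (- C)) (exp C) L"
  define S where "S = D \<times> {\<alpha>..\<beta>}"
  define Y where "Y = (\<lambda>(u :: real \<Rightarrow>\<^sub>C real, r :: real) t. r * u t)"
  define clip where "clip r = max \<alpha> (min \<beta> r)" for r
  define F where "F p = (Bcontfun (V (Y p)), clip (snd p + \<sigma> * (\<rho> (Y p) - snd p)))" for p

  have Y: "Y p \<in> periodic_band T lo hi" if "p \<in> S" for p
  proof -
    obtain u r where p: "p = (u, r)" by force
    have u: "u t \<in> {exp (- C)..exp C}" "u (t + T) = u t" for t
      using that by (auto simp: p S_def D_def lipschitz_periodic_def)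
    have r: "r \<in> {\<alpha>..\<beta>}" using that by (simp add: p S_def)
    have "0 \<le> u t" for t
      using u(1)[of t] order_trans[OF exp_ge_zero, of "- C" "u t"] by simp
    then have "\<alpha> * exp (- C) \<le> r * u t" "r * u t \<le> \<beta> * exp C" for t
      using mult_mono[of \<alpha> r "exp (- C)" "u t"] mult_mono[of r \<beta> "u t" "exp C"] u(1)[of t] r ab
      by simp_all
    then show ?thesis
      by (auto simp: periodic_band_def Y_def p u(2) lo_def hi_def intro!: continuous_intros)
  qed
  have Vapp: "apply_bcontfun (Bcontfun (V (Y p))) = V (Y p)" if "p \<in> S" for p
  proof (rule Bcontfun_inverse, rule bcontfun_normI[OF V_cont[OF lo Y[OF that]]])
    show "norm (V (Y p) t) \<le> exp C" for t
      using V_Icc[OF lo Y[OF that], of t] V_pos[OF lo Y[OF that], of t] by simp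
  qed
  have V_D: "Bcontfun (V (Y p)) \<in> D" if "p \<in> S" for p
    unfolding D_def lipschitz_periodic_def mem_Collect_eq Vapp[OF that]
  proof (intro conjI allI)
    note Yp = lo Y[OF that]
    show "V (Y p) (t + T) = V (Y p) t" "V (Y p) t \<in> {exp (- C)..exp C}" for t
      using V_periodic[OF Yp] V_Icc[OF Yp] by auto
    fix s t
    show "\<bar>V (Y p) s - V (Y p) t\<bar> \<le> L * \<bar>s - t\<bar>"
    proof (rule bounded_derivative_imp_lipschitz[OF convex_UNIV V_deriv[OF Yp]])
      fix t
      have "\<Phi> (Y p) t / \<rho> (Y p) \<le> d / \<rho>0" "0 \<le> \<Phi> (Y p) t / \<rho> (Y p)"
        using cd[OF Yp(2), of t] c \<rho>0 \<rho>0_le[OF Yp(2)] by (auto intro!: frac_le divide_nonneg_nonneg)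
      moreover have "b t * V (Y p) t \<le> b tb * exp C" "0 \<le> b t * V (Y p) t"
        using V_Icc[OF Yp, of t] V_pos[OF Yp, of t] b_pos[of t] b_pos[of tb] tb[of t]
        by (auto intro!: mult_mono)
      moreover have "0 \<le> d / \<rho>0" "0 \<le> b tb * exp C"
        using calculation by linarith+
      ultimately show "\<bar>\<Phi> (Y p) t / \<rho> (Y p) - b t * V (Y p) t\<bar> \<le> L"
        unfolding L_def by linarith
    qed auto
  qed

  have Y_close: "\<exists>e>0. \<forall>q\<in>S. dist q p < e \<longrightarrow> (\<forall>t. \<bar>\<Phi> (Y q) t - \<Phi> (Y p) t\<bar> \<le> \<eta>)"
    if p: "p \<in> S" and "0 < \<eta>" for p \<eta>
  proof -
    obtain \<epsilon> where \<epsilon>: "0 < \<epsilon>" "\<And>x y t. x \<in> periodic_band T lo hi \<Longrightarrow> y \<in> periodic_band T lo hi \<Longrightarrow>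
        (\<And>t. \<bar>x t - y t\<bar> < \<epsilon>) \<Longrightarrow> \<bar>\<Phi> x t - \<Phi> y t\<bar> < \<eta>"
      using feedback_unif[OF lo \<open>0 < \<eta>\<close>] by meson
    obtain v r' where p': "p = (v, r')" by force
    \<comment> \<open>Comes from \<open>r * u - r' * v = r * (u - v) + (r - r') * v\<close> with
      \<open>\<bar>r\<bar> \<le> \<beta>\<close> and
      \<open>\<bar>v\<bar> \<le> exp C\<close>.\<close>
    let ?e = "\<epsilon> / (\<beta> + exp C)"
    have pos: "0 < \<beta> + exp C" using ab by (simp add: add_nonneg_pos)
    have "\<bar>\<Phi> (Y q) t - \<Phi> (Y p) t\<bar> \<le> \<eta>" if q: "q \<in> S" "dist q p < ?e" for q t
    proof (intro less_imp_le \<epsilon>(2) Y p q(1))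
      fix t
      obtain u r where q': "q = (u, r)" by force
      have "dist (u t) (v t) < ?e" "dist r r' < ?e"
        using dist_bounded[of u t v] dist_fst_le[of q p] dist_snd_le[of q p] q(2)
        by (auto simp: p' q')
      then have close: "\<bar>u t - v t\<bar> < ?e" "\<bar>r - r'\<bar> < ?e" by (auto simp: dist_real_def)
      have r: "\<bar>r\<bar> \<le> \<beta>" using q(1) ab by (auto simp: q' S_def)
      have v: "\<bar>v t\<bar> \<le> exp C"
      proof -
        have "v t \<in> {exp (- C)..exp C}" using p by (auto simp: p' S_def D_def lipschitz_periodic_def)
        then show ?thesis using exp_gt_zero[of "- C"] by (simp add: abs_le_iff del: exp_gt_zero)
      qed
      have "r * u t - r' * v t = r * (u t - v t) + (r - r') * v t" by (simp add: algebra_simps)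
      also have "\<bar>\<dots>\<bar> \<le> \<bar>r\<bar> * \<bar>u t - v t\<bar> + \<bar>r - r'\<bar> * \<bar>v t\<bar>"
        by (metis abs_mult abs_triangle_ineq)
      also have "\<dots> \<le> \<beta> * \<bar>u t - v t\<bar> + \<bar>r - r'\<bar> * exp C"
        using r v by (intro add_mono mult_mono) auto
      also have "\<dots> < \<beta> * ?e + ?e * exp C"
        using close ab by (intro add_strict_mono mult_strict_left_mono mult_strict_right_mono) auto
      also have "\<dots> = (\<beta> + exp C) * ?e"
        by (simp only: distrib_right mult.commute)
      also have "\<dots> = \<epsilon>"
        using pos by simp
      finally show "\<bar>Y q t - Y p t\<bar> < \<epsilon>" by (simp add: Y_def p' q')
    qed
    moreover have "0 < ?e" using \<epsilon>(1) pos by simp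
    ultimately show ?thesis by blast
  qed
  have cont_\<rho>: "continuous_on S (\<lambda>p. \<rho> (Y p))"
    unfolding continuous_on_iff
  proof (intro ballI allI impI)
    fix p and e :: real assume p: "p \<in> S" and "0 < e"
    define k where "k = exp C * T / (exp C - 1)"
    have k: "0 < k" using T_pos C_pos by (simp add: k_def)
    obtain \<epsilon> where \<epsilon>: "0 < \<epsilon>" "\<And>q t. q \<in> S \<Longrightarrow> dist q p < \<epsilon> \<Longrightarrow> \<bar>\<Phi> (Y q) t - \<Phi> (Y p) t\<bar> \<le> e / (2 * k)"
      using Y_close[OF p, of "e / (2 * k)"] \<open>0 < e\<close> k by auto
    have "dist (\<rho> (Y q)) (\<rho> (Y p)) < e" if "q \<in> S" "dist q p < \<epsilon>" for q
      using V_close(1)[OF lo Y[OF that(1)] Y[OF p] \<epsilon>(2)[OF that]] k \<open>0 < e\<close>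
      by (simp add: dist_real_def k_def[symmetric])
    with \<epsilon>(1) show "\<exists>\<epsilon>>0. \<forall>q\<in>S. dist q p < \<epsilon> \<longrightarrow> dist (\<rho> (Y q)) (\<rho> (Y p)) < e" by blast
  qed
  have cont_V: "continuous_on S (\<lambda>p. Bcontfun (V (Y p)))"
    unfolding continuous_on_iff
  proof (intro ballI allI impI)
    fix p and e :: real assume p: "p \<in> S" and "0 < e"
    define k where "k = 2 * exp C * T / \<rho> (Y p)"
    have k: "0 < k" using T_pos \<rho>_pos[OF lo Y[OF p]] by (simp add: k_def)
    obtain \<epsilon> where \<epsilon>: "0 < \<epsilon>" "\<And>q t. q \<in> S \<Longrightarrow> dist q p < \<epsilon> \<Longrightarrow> \<bar>\<Phi> (Y q) t - \<Phi> (Y p) t\<bar> \<le> e / (2 * k)"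
      using Y_close[OF p, of "e / (2 * k)"] \<open>0 < e\<close> k by auto
    have "dist (Bcontfun (V (Y q))) (Bcontfun (V (Y p))) < e" if q: "q \<in> S" "dist q p < \<epsilon>" for q
    proof (rule le_less_trans[OF dist_bound])
      show "dist (Bcontfun (V (Y q)) t) (Bcontfun (V (Y p)) t) \<le> e / 2" for t
        using V_close(2)[OF lo Y[OF q(1)] Y[OF p] \<epsilon>(2)[OF q], of t] k
        by (simp add: dist_real_def Vapp[OF p] Vapp[OF q(1)] k_def[symmetric])
    qed (use \<open>0 < e\<close> in simp)
    with \<epsilon>(1) show "\<exists>\<epsilon>>0. \<forall>q\<in>S. dist q p < \<epsilon> \<longrightarrow> dist (Bcontfun (V (Y q))) (Bcontfun (V (Y p))) < e"
      by blast
  qed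
  obtain p where p: "p \<in> S" "F p = p"
  proof (rule schauder[of S F])
    show "compact S"
      unfolding S_def D_def by (intro compact_Times compact_lipschitz_periodic T_pos compact_Icc)
    show "convex S"
      unfolding S_def D_def by (intro convex_Times convex_lipschitz_periodic convex_real_interval)
    \<comment> \<open>A negative \<open>L\<close> would make \<open>D\<close> empty. The sign of
      \<open>d\<close> is read off from the constant function \<open>lo\<close>, a member of the
      band.\<close>
    have "0 \<le> L"
    proof -
      have "(\<lambda>t. lo) \<in> periodic_band T lo hi"
        using ab C_pos by (auto simp: periodic_band_def lo_def hi_def intro!: mult_mono)
      from cd[OF this, of 0] c \<rho>0 b_pos[of tb] show ?thesis by (simp add: L_def)
    qed
    then have "(const_bcontfun 1, \<alpha>) \<in> S"
      using C_pos ab by (simp add: S_def D_def lipschitz_periodic_def)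
    then show "S \<noteq> {}" by blast
    show "continuous_on S F"
      unfolding F_def clip_def by (intro continuous_intros cont_\<rho> cont_V)
    show "F \<in> S \<rightarrow> S"
      using V_D ab by (auto simp: F_def S_def clip_def)
  qed
  define x where "x = Y p"
  obtain u r where ur: "p = (u, r)" by force
  have x: "x \<in> periodic_band T lo hi" unfolding x_def by (rule Y[OF p(1)])
  note lx = lo x
  have r: "r \<in> {\<alpha>..\<beta>}" "0 < r" using p(1) ab by (auto simp: ur S_def)
  have "u = Bcontfun (V x)" and r_eq: "r = clip (r + \<sigma> * (\<rho> x - r))"
    using p(2) by (auto simp: F_def ur x_def)
  then have uV: "apply_bcontfun u = V x" using Vapp[OF p(1)] by (simp add: x_def)
  have xV: "x t = r * V x t" for t
    by (metis Y_def case_prod_conv uV ur x_def)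
  have x_deriv: "(x has_real_derivative r * (\<Phi> x t / \<rho> x - b t * V x t)) (at t)" for t
    using DERIV_cmult[OF V_deriv[OF lx], of r t] by (simp flip: xV)
  have x_pos: "0 < x t" for t using xV[of t] V_pos[OF lx, of t] r by simp
  have xp: "x (t + T) = x t" for t using x by (simp add: periodic_band_def)
  obtain t where t: "\<And>s. x s \<le> x t"
    using periodic_attains_sup[OF T_pos, of x] x by (auto simp: periodic_band_def)
  define X where "X = x t"
  have X: "0 < X" using x_pos by (simp add: X_def)
  have band: "x \<in> periodic_band T (exp (- C) * X) X"
  proof -
    have "exp (- C) * X \<le> x s" for s
      using V_harnack[OF lx, of t s] r by (simp add: X_def xV[of t] xV[of s])
    then show ?thesis using x t by (auto simp: periodic_band_def X_def)
  qed
  have "r * (\<Phi> x t / \<rho> x - b t * V x t) = 0"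
    by (rule DERIV_local_max[OF x_deriv[of t], of 1]) (use t in auto)
  then have "\<Phi> x t = \<rho> x * (b t * V x t)"
    using r \<rho>_pos[OF lx] by (simp add: field_simps)
  \<comment> \<open>As \<open>b t * V x t\<close> is positive, the sign of
    \<open>\<rho> x - r\<close> can be read off from the equation at the maximum.\<close>
  then have eq: "\<Phi> x t - b t * X = (\<rho> x - r) * (b t * V x t)"
    by (simp add: X_def xV[of t] algebra_simps)
  have bV: "0 < b t * V x t" using b_pos[of t] V_pos[OF lx, of t] by simp
  have "\<rho> x = r"
  proof (rule ccontr)
    assume ne: "\<rho> x \<noteq> r"
    then have ne': "\<sigma> * (\<rho> x - r) \<noteq> 0" using \<sigma> by auto
    \<comment> \<open>Clipping \<open>r + h\<close> with \<open>h \<noteq> 0\<close> can return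
      \<open>r\<close> only at an end point of the interval, with \<open>h\<close> pointing
      outwards.\<close>
    then consider "r = \<alpha>" "\<sigma> * (\<rho> x - r) < 0" | "r = \<beta>" "\<sigma> * (\<rho> x - r) > 0"
    proof -
      define h where "h = \<sigma> * (\<rho> x - r)"
      have "r = max \<alpha> (min \<beta> (r + h))" "h \<noteq> 0"
        using r_eq ne' by (auto simp: clip_def h_def)
      then have "r = \<alpha> \<and> h < 0 \<or> r = \<beta> \<and> h > 0"
        using r(1) by (auto simp: max_def min_def split: if_splits)
      with that show ?thesis by (auto simp: h_def)
    qed
    then show False
    proof cases
      case 1
      have "X \<le> \<alpha> * exp C"
        using V_Icc[OF lx, of t] ab by (simp add: X_def xV[of t] 1(1))
      also have "\<dots> = \<delta>" by (simp add: \<alpha>_def flip: exp_add)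
      finally have "0 \<le> \<sigma> * (\<rho> x - r) * (b t * V x t)"
        using small[OF X _ band, of t] by (simp add: eq X_def[symmetric] mult.assoc)
      with 1(2) bV show False by (meson mult_neg_pos not_less)
    next
      case 2
      have "\<beta> \<le> X" using t[of 0] by (simp add: X_def xV[of 0] V_0[OF lx] 2(1))
      then have "\<sigma> * (\<rho> x - r) * (b t * V x t) \<le> 0"
        using large[OF X _ band, of t] ab by (simp add: eq X_def[symmetric] mult.assoc)
      with 2(2) bV show False by (meson mult_pos_pos not_less)
    qed
  qed
  then have "(x has_real_derivative \<Phi> x s - b s * x s) (at s)" for s
    using x_deriv[of s] r by (simp add: xV[of s] right_diff_distrib mult_ac)
  with x_pos xp show ?thesis by (rule that)
qed

end

section \<open>The delay equation\<close>

context
  fixes T C :: real and M :: nat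
    and lam m n :: "nat \<Rightarrow> real"
    and r \<tau> \<mu> :: "nat \<Rightarrow> real \<Rightarrow> real"
    and b :: "real \<Rightarrow> real"
  assumes T_gt_0: "T > 0" and M_ge_1: "M \<ge> 1"
    and params: "\<And>k. k \<in> {1..M} \<Longrightarrow> lam k > 0 \<and> m k > 0 \<and> n k > 0"
    and coeffs: "\<And>k. k \<in> {1..M} \<Longrightarrow> positive_periodic_coeff T (r k) \<and>
      positive_periodic_coeff T (\<tau> k) \<and> positive_periodic_coeff T (\<mu> k)"
    and b_coeff: "positive_periodic_coeff T b"
    and C: "C = integral {0..T} b"
begin

lemma weight_coeff: "k \<in> {1..M} \<Longrightarrow> positive_periodic_coeff T (\<lambda>t. lam k * r k t)"
  using coeffs[of k] params[of k]
  by (auto simp: positive_periodic_coeff_def periodic_fun_simple_def intro!: continuous_intros)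

lemma weight_nonneg: "k \<in> {1..M} \<Longrightarrow> 0 \<le> lam k * r k t"
  using positive_periodic_coeffD(3)[OF weight_coeff, of k t] by simp

section \<open>The production term as a feedback operator\<close>

definition nonlin :: "nat \<Rightarrow> (real \<Rightarrow> real) \<Rightarrow> real \<Rightarrow> real"
  where "nonlin k x t = x (t - \<tau> k t) powr m k / (1 + x (t - \<mu> k t) powr n k)"

definition production :: "(real \<Rightarrow> real) \<Rightarrow> real \<Rightarrow> real"
  where "production x t = (\<Sum>k=1..M. lam k * r k t * nonlin k x t)"

text \<open>The two delayed values are treated as independent numbers in the band; the quotient
  increases in the first and decreases in the second.\<close>

lemma nonlin_bounds:
  assumes "0 < lo" "\<And>t. x t \<in> {lo..hi}" "k \<in> {1..M}"
  shows "lo powr m k / (1 + hi powr n k) \<le> nonlin k x t"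
    and "nonlin k x t \<le> hi powr m k / (1 + lo powr n k)"
proof -
  have "lo \<le> x (t - \<tau> k t)" "x (t - \<tau> k t) \<le> hi" "lo \<le> x (t - \<mu> k t)" "x (t - \<mu> k t) \<le> hi"
    using assms(2) by (simp_all only: atLeastAtMost_iff)
  note b = \<open>0 < lo\<close> this params[OF assms(3), THEN conjunct2]
  show "lo powr m k / (1 + hi powr n k) \<le> nonlin k x t"
    unfolding nonlin_def by (rule powr_quotient_bounds(1)) (use b in blast)+
  show "nonlin k x t \<le> hi powr m k / (1 + lo powr n k)"
    unfolding nonlin_def by (rule powr_quotient_bounds(2)) (use b in blast)+
qed

lemma nonlin_cont:
  assumes "0 < lo" "x \<in> periodic_band T lo hi" "k \<in> {1..M}"
  shows "continuous_on UNIV (nonlin k x)"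
proof -
  have x: "continuous_on UNIV x" "\<And>t. lo \<le> x t"
    using assms(2) by (auto simp: periodic_band_def)
  have x_ne: "x t \<noteq> 0" for t using x(2)[of t] \<open>0 < lo\<close> by linarith
  have "continuous_on UNIV (\<tau> k)" "continuous_on UNIV (\<mu> k)"
    using coeffs[OF assms(3)] by (auto simp: positive_periodic_coeff_def)
  moreover have "1 + x t powr n k \<noteq> 0" for t
    using powr_ge_zero[of "x t" "n k"] by linarith
  ultimately show ?thesis
    unfolding nonlin_def[abs_def]
    by (intro continuous_intros continuous_on_compose2[OF x(1)]) (auto simp: x_ne)
qed

lemma nonlin_periodic:
  assumes "x \<in> periodic_band T lo hi" "k \<in> {1..M}"
  shows "nonlin k x (t + T) = nonlin k x t"
proof -
  have x: "x (s + T) = x s" for s using assms(1) by (simp add: periodic_band_def)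
  have "\<tau> k (t + T) = \<tau> k t" "\<mu> k (t + T) = \<mu> k t"
    using coeffs[OF assms(2)] positive_periodic_coeffD(2) by blast+
  then have "t + T - \<tau> k (t + T) = t - \<tau> k t + T" "t + T - \<mu> k (t + T) = t - \<mu> k t + T"
    by simp_all
  then show ?thesis
    unfolding nonlin_def by (simp only: x)
qed

text \<open>Each term is a fixed function \<open>h\<close> of the pair of delayed values. It is
  uniformly continuous on a compact square away from 0, so \<open>d\<close> depends neither on
  \<open>t\<close> nor on the delays.\<close>

lemma nonlin_unif:
  assumes "0 < lo" "k \<in> {1..M}" "0 < e"
  shows "\<exists>d>0. \<forall>x\<in>periodic_band T lo hi. \<forall>y\<in>periodic_band T lo hi.
    (\<forall>t. \<bar>x t - y t\<bar> < d) \<longrightarrow> (\<forall>t. \<bar>nonlin k x t - nonlin k y t\<bar> < e)"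
proof -
  define h where "h p = fst p powr m k / (1 + snd p powr n k)" for p :: "real \<times> real"
  let ?R = "{lo..hi} \<times> {lo..hi}"
  have "1 + q powr n k \<noteq> 0" for q
    using powr_ge_zero[of q "n k"] by linarith
  then have "continuous_on ?R h"
    unfolding h_def[abs_def] using \<open>0 < lo\<close> by (intro continuous_intros) auto
  then have "uniformly_continuous_on ?R h"
    by (intro compact_uniformly_continuous compact_Times compact_Icc)
  then obtain d where d: "0 < d" "\<And>p q. p \<in> ?R \<Longrightarrow> q \<in> ?R \<Longrightarrow> dist p q < d \<Longrightarrow> dist (h p) (h q) < e"
    using \<open>0 < e\<close> unfolding uniformly_continuous_on_def by metis
  show ?thesis
  proof (intro exI[of _ "d / 2"] conjI ballI allI impI)
    fix x y t
    assume xy: "x \<in> periodic_band T lo hi" "y \<in> periodic_band T lo hi" "\<forall>t. \<bar>x t - y t\<bar> < d / 2"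
    let ?s = "t - \<tau> k t" and ?s' = "t - \<mu> k t"
    have "dist (x ?s, x ?s') (y ?s, y ?s') \<le> \<bar>x ?s - y ?s\<bar> + \<bar>x ?s' - y ?s'\<bar>"
      by (simp add: dist_Pair_Pair dist_real_def sqrt_sum_squares_le_sum_abs[THEN order_trans])
    also have "\<dots> < d" using xy(3)[rule_format, of ?s] xy(3)[rule_format, of ?s'] by linarith
    finally have "dist (h (x ?s, x ?s')) (h (y ?s, y ?s')) < e"
      using xy(1,2) by (intro d(2)) (auto simp: periodic_band_def)
    then show "\<bar>nonlin k x t - nonlin k y t\<bar> < e"
      by (simp add: h_def nonlin_def dist_real_def)
  qed (use d in simp)
qed

lemma production_unif:
  assumes "0 < lo" "0 < e"
  shows "\<exists>d>0. \<forall>x\<in>periodic_band T lo hi. \<forall>y\<in>periodic_band T lo hi.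
    (\<forall>t. \<bar>x t - y t\<bar> < d) \<longrightarrow> (\<forall>t. \<bar>production x t - production y t\<bar> < e)"
proof -
  have "\<forall>k\<in>{1..M}. \<exists>A>0. \<forall>t. lam k * r k t \<le> A"
    using positive_periodic_coeff_bounds[OF weight_coeff T_gt_0] by (metis order_trans less_le_trans)
  then obtain A where A: "\<And>k. k \<in> {1..M} \<Longrightarrow> 0 < A k" "\<And>k t. k \<in> {1..M} \<Longrightarrow> lam k * r k t \<le> A k"
    by metis
  \<comment> \<open>The tolerance \<open>e / (M * A k)\<close> leaves each weighted term an error
    below \<open>e / M\<close>.\<close>
  have "\<forall>k\<in>{1..M}. \<exists>d>0. \<forall>x\<in>periodic_band T lo hi. \<forall>y\<in>periodic_band T lo hi.
    (\<forall>t. \<bar>x t - y t\<bar> < d) \<longrightarrow> (\<forall>t. \<bar>nonlin k x t - nonlin k y t\<bar> < e / (M * A k))"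
    using nonlin_unif[OF \<open>0 < lo\<close>] A(1) \<open>0 < e\<close> M_ge_1 by simp
  then obtain d where d: "\<And>k. k \<in> {1..M} \<Longrightarrow> 0 < d k"
    "\<And>k x y t. k \<in> {1..M} \<Longrightarrow> x \<in> periodic_band T lo hi \<Longrightarrow> y \<in> periodic_band T lo hi \<Longrightarrow>
      (\<And>t. \<bar>x t - y t\<bar> < d k) \<Longrightarrow> \<bar>nonlin k x t - nonlin k y t\<bar> < e / (M * A k)"
    by metis
  have ne: "{1..M} \<noteq> {}" using M_ge_1 by simp
  show ?thesis
  proof (intro exI[of _ "Min (d ` {1..M})"] conjI ballI allI impI)
    show "0 < Min (d ` {1..M})" using d(1) ne by simp
    fix x y t
    assume xy: "x \<in> periodic_band T lo hi" "y \<in> periodic_band T lo hi"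
      and close: "\<forall>t. \<bar>x t - y t\<bar> < Min (d ` {1..M})"
    have small: "\<bar>lam k * r k t * (nonlin k x t - nonlin k y t)\<bar> < e / M" if k: "k \<in> {1..M}" for k
    proof -
      have "\<bar>nonlin k x t - nonlin k y t\<bar> < e / (M * A k)"
      proof (rule d(2)[OF k xy])
        show "\<bar>x t - y t\<bar> < d k" for t
          using less_le_trans[OF close[rule_format] Min_le] k by simp
      qed
      then have "A k * \<bar>nonlin k x t - nonlin k y t\<bar> < e / M"
        using A(1)[OF k] M_ge_1 by (simp add: field_simps)
      moreover have "\<bar>lam k * r k t * (nonlin k x t - nonlin k y t)\<bar>
          \<le> A k * \<bar>nonlin k x t - nonlin k y t\<bar>"
        using A(2)[OF k, of t] positive_periodic_coeffD(3)[OF weight_coeff[OF k], of t]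
        by (simp only: abs_mult[of "lam k * r k t"]) (simp add: mult_right_mono)
      ultimately show ?thesis by linarith
    qed
    have "\<bar>production x t - production y t\<bar> = \<bar>\<Sum>k=1..M. lam k * r k t * (nonlin k x t - nonlin k y t)\<bar>"
      by (simp add: production_def right_diff_distrib sum_subtractf)
    also have "\<dots> \<le> (\<Sum>k=1..M. \<bar>lam k * r k t * (nonlin k x t - nonlin k y t)\<bar>)"
      by (rule sum_abs)
    also have "\<dots> < (\<Sum>k=1..M. e / M)"
      using small ne by (intro sum_strict_mono) auto
    also have "\<dots> = e" using M_ge_1 by simp
    finally show "\<bar>production x t - production y t\<bar> < e" .
  qed
qed

lemma production_bounds:
  assumes "0 < lo"
  shows "\<exists>c d. 0 < c \<and> (\<forall>x\<in>periodic_band T lo hi. \<forall>t. production x t \<in> {c..d})"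
proof -
  have "\<forall>k\<in>{1..M}. \<exists>a A. 0 < a \<and> (\<forall>t. a \<le> lam k * r k t) \<and> (\<forall>t. lam k * r k t \<le> A)"
    using positive_periodic_coeff_bounds[OF weight_coeff T_gt_0] by metis
  then obtain a A where a: "\<And>k. k \<in> {1..M} \<Longrightarrow> 0 < a k"
    and aA: "\<And>k t. k \<in> {1..M} \<Longrightarrow> a k \<le> lam k * r k t" "\<And>k t. k \<in> {1..M} \<Longrightarrow> lam k * r k t \<le> A k"
    by metis
  let ?c = "\<Sum>k=1..M. a k * (lo powr m k / (1 + hi powr n k))"
  let ?d = "\<Sum>k=1..M. A k * (hi powr m k / (1 + lo powr n k))"
  have nonneg: "0 \<le> lo powr m k / (1 + hi powr n k)" for k
    by (simp add: add_nonneg_nonneg)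
  have "production x t \<in> {?c..?d}" if "x \<in> periodic_band T lo hi" for x t
  proof -
    have x: "\<And>t. x t \<in> {lo..hi}" using that by (simp add: periodic_band_def)
    have "a k * (lo powr m k / (1 + hi powr n k)) \<le> lam k * r k t * nonlin k x t"
      "lam k * r k t * nonlin k x t \<le> A k * (hi powr m k / (1 + lo powr n k))" if k: "k \<in> {1..M}" for k
    proof -
      note b = nonlin_bounds[of lo x hi k t, OF \<open>0 < lo\<close> x k] aA[OF k, of t] a[OF k] nonneg[of k]
      show "a k * (lo powr m k / (1 + hi powr n k)) \<le> lam k * r k t * nonlin k x t"
        using b by (intro mult_mono) linarith+
      show "lam k * r k t * nonlin k x t \<le> A k * (hi powr m k / (1 + lo powr n k))"
        using b by (intro mult_mono) linarith+
    qed
    then show ?thesis by (auto simp: production_def intro: sum_mono)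
  qed
  moreover have "0 < ?c" if "x \<in> periodic_band T lo hi" for x
  proof (rule sum_pos)
    fix k assume "k \<in> {1..M}"
    then show "0 < a k * (lo powr m k / (1 + hi powr n k))"
      using a \<open>0 < lo\<close> by (simp add: add_pos_nonneg)
  qed (use M_ge_1 in auto)
  ultimately show ?thesis
    by (cases "periodic_band T lo hi = {}") (use zero_less_one in blast)+
qed

lemma production_cont:
  assumes "0 < lo" "x \<in> periodic_band T lo hi"
  shows "continuous_on UNIV (production x)"
  unfolding production_def[abs_def]
  by (intro continuous_on_sum continuous_on_mult nonlin_cont[OF assms]
      positive_periodic_coeffD(1)[OF weight_coeff]) auto

lemma production_periodic:
  assumes "x \<in> periodic_band T lo hi"
  shows "production x (t + T) = production x t"
  unfolding production_def
  by (intro sum.cong refl arg_cong2[of _ _ _ _ "(*)"] nonlin_periodic[OF assms]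
      positive_periodic_coeffD(2)[OF weight_coeff]) auto

lemma production_solution:
  fixes \<sigma> \<delta> R :: real
  assumes "\<bar>\<sigma>\<bar> = 1" and "0 < \<delta>"
    and "\<And>x t X. 0 < X \<Longrightarrow> X \<le> \<delta> \<Longrightarrow> x \<in> periodic_band T (exp (- C) * X) X \<Longrightarrow> x t = X \<Longrightarrow>
      0 \<le> \<sigma> * (production x t - b t * X)"
    and "\<And>x t X. 0 < X \<Longrightarrow> R \<le> X \<Longrightarrow> x \<in> periodic_band T (exp (- C) * X) X \<Longrightarrow> x t = X \<Longrightarrow>
      \<sigma> * (production x t - b t * X) \<le> 0"
  shows "\<exists>x. positive_periodic_solution T M lam m n r \<tau> \<mu> b x"
proof -
  have B: "\<And>t. (antideriv b has_real_derivative b t) (at t)" "antideriv b T = C"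
    using has_real_derivative_antideriv[OF positive_periodic_coeffD(1)[OF b_coeff]] T_gt_0
    by (auto simp: C antideriv_eq_integral)
  show ?thesis
  proof (rule positive_periodic_solution_exists[of T b "antideriv b" C production \<sigma> \<delta> R])
    fix x
    assume "\<And>t. 0 < x t" "\<And>t. x (t + T) = x t"
      "\<And>t. (x has_real_derivative production x t - b t * x t) (at t)"
    then show ?thesis
      unfolding positive_periodic_solution_def periodic_fun_simple_def
      by (auto simp: production_def nonlin_def)
  next
    show "production x (t + T) = production x t" if "x \<in> periodic_band T lo hi" for lo hi x t
      by (rule production_periodic[OF that])
  qed (fact T_gt_0 b_coeff B antideriv_0 production_cont production_bounds
      production_unif assms)+
qed

section \<open>Bounds relative to the maximum of the solution\<close>

text \<open>For \<open>x\<close> between \<open>exp (- C) * X\<close> and \<open>X\<close>, the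
  quotient of \<open>nonlin k x t\<close> by \<open>X\<close> lies between \<open>low k X\<close>
  and \<open>up k X\<close>: numerator and denominator are evaluated at opposite ends of the
  band.\<close>

definition low :: "nat \<Rightarrow> real \<Rightarrow> real"
  where "low k X = exp (- C) powr m k * X powr (m k - 1) / (1 + X powr n k)"

definition up :: "nat \<Rightarrow> real \<Rightarrow> real"
  where "up k X = X powr (m k - 1) / (1 + (exp (- C) * X) powr n k)"

lemma production_low_up:
  assumes X: "0 < X" and x: "x \<in> periodic_band T (exp (- C) * X) X"
  shows "X * (\<Sum>k=1..M. lam k * r k t * low k X) \<le> production x t"
    and "production x t \<le> X * (\<Sum>k=1..M. lam k * r k t * up k X)"
proof -
  have pow: "X powr m k = X * X powr (m k - 1)" for k
    using X by (simp add: powr_diff)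
  have xX: "\<And>t. x t \<in> {exp (- C) * X..X}" using x by (simp add: periodic_band_def)
  have pos: "0 < exp (- C) * X" using X by simp
  have bnd: "X * low k X \<le> nonlin k x t" "nonlin k x t \<le> X * up k X" if k: "k \<in> {1..M}" for k
    using nonlin_bounds[of _ x X k t, OF pos xX k] by (simp_all add: low_def up_def pow powr_mult mult_ac)
  have "(\<Sum>k=1..M. lam k * r k t * (X * low k X)) \<le> production x t"
    unfolding production_def by (intro sum_mono mult_left_mono bnd weight_nonneg)
  then show "X * (\<Sum>k=1..M. lam k * r k t * low k X) \<le> production x t"
    by (simp add: sum_distrib_left mult_ac)
  have "production x t \<le> (\<Sum>k=1..M. lam k * r k t * (X * up k X))"
    unfolding production_def by (intro sum_mono mult_left_mono bnd weight_nonneg)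
  then show "production x t \<le> X * (\<Sum>k=1..M. lam k * r k t * up k X)"
    by (simp add: sum_distrib_left mult_ac)
qed

lemma production_le:
  assumes "\<forall>t. (\<Sum>k=1..M. lam k * r k t * up k X) \<le> b t"
    and "0 < X" "x \<in> periodic_band T (exp (- C) * X) X"
  shows "production x t \<le> b t * X"
proof -
  have "X * (\<Sum>k=1..M. lam k * r k t * up k X) \<le> X * b t"
    using assms(1,2) by (intro mult_left_mono) auto
  with production_low_up(2)[OF assms(2,3), of t] show ?thesis by (simp add: mult.commute)
qed

lemma production_ge:
  assumes "\<forall>t. b t \<le> (\<Sum>k=1..M. lam k * r k t * low k X)"
    and "0 < X" "x \<in> periodic_band T (exp (- C) * X) X"
  shows "b t * X \<le> production x t"
proof -
  have "X * b t \<le> X * (\<Sum>k=1..M. lam k * r k t * low k X)"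
    using assms(1,2) by (intro mult_left_mono) auto
  with production_low_up(1)[OF assms(2,3), of t] show ?thesis by (simp add: mult.commute)
qed

text \<open>The factor \<open>* 1\<close> gives the limit the shape expected by
  \<open>sum_mult_of_bool\<close>.\<close>

lemma up_at_0:
  assumes "k \<in> {1..M}" "1 \<le> m k"
  shows "(up k \<longlongrightarrow> of_bool (m k = 1) * 1) (at_right 0)"
  using tendsto_powr_quotient_at_0[of "exp (- C)" "n k" "m k"] params[OF assms(1)] assms(2)
  by (simp add: up_def[abs_def])

text \<open>The factor \<open>exp (C * n k)\<close> comes from the denominator of \<open>up\<close>,
  which is evaluated at the lower end \<open>exp (- C) * X\<close>.\<close>

lemma up_at_top:
  assumes "k \<in> {1..M}" "m k \<le> n k + 1"
  shows "(up k \<longlongrightarrow> of_bool (m k = n k + 1) * exp (C * n k)) at_top"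
  using tendsto_powr_quotient_at_top[of "exp (- C)" "n k" "m k"] params[OF assms(1)] assms(2)
  by (simp add: up_def[abs_def] exp_powr_real)

text \<open>Here the denominator has scale 1, and \<open>exp (- C * m k)\<close> comes from the
  numerator at the lower end of the band.\<close>

lemma low_at_top:
  assumes "k \<in> {1..M}" "m k \<le> n k + 1"
  shows "(low k \<longlongrightarrow> of_bool (m k = n k + 1) * exp (- C * m k)) at_top"
proof -
  have "((\<lambda>X. X powr (m k - 1) / (1 + X powr n k)) \<longlongrightarrow> of_bool (m k = n k + 1)) at_top"
    using tendsto_powr_quotient_at_top[of 1 "n k" "m k"] params[OF assms(1)] assms(2) by simp
  from tendsto_mult_left[OF this, of "exp (- C * m k)"] show ?thesis
    by (simp add: low_def[abs_def] exp_powr_real mult.commute)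
qed

lemma low_at_0:
  assumes "k \<in> {1..M}" "m k < 1"
  shows "filterlim (low k) at_top (at_right 0)"
  unfolding low_def[abs_def]
  using params[OF assms(1)] assms(2) by (intro powr_quotient_at_top_at_0) auto

section \<open>The superlinear and the sublinear case\<close>

text \<open>Serves cases 1 and 2. Consumption dominates for small \<open>X\<close> by the limit of
  \<open>up\<close> at 0, production dominates for large \<open>X\<close> by the limit of
  \<open>low\<close> at infinity.\<close>

lemma superlinear_solution:
  assumes m_ge: "\<And>k. k \<in> {1..M} \<Longrightarrow> 1 \<le> m k" and m_le: "\<And>k. k \<in> {1..M} \<Longrightarrow> m k \<le> n k + 1"
    and small: "\<And>t. (\<Sum>k | k \<in> {1..M} \<and> m k = 1. lam k * r k t) < b t"
    and large: "\<And>t. b t < (\<Sum>k | k \<in> {1..M} \<and> m k = n k + 1. lam k * r k t * exp (- C * m k))"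
  shows "\<exists>x. positive_periodic_solution T M lam m n r \<tau> \<mu> b x"
proof -
  have "\<forall>\<^sub>F X in at_right 0. \<forall>t. (\<Sum>k=1..M. lam k * r k t * up k X) \<le> b t"
  proof (rule eventually_weighted_sum_le[OF _ T_gt_0 weight_coeff up_at_0[OF _ m_ge] b_coeff])
    show "(\<Sum>k=1..M. lam k * r k t * (of_bool (m k = 1) * 1)) < b t" for t
      using small[of t]
        sum_mult_of_bool[of "{1..M}" "\<lambda>k. lam k * r k t" "\<lambda>k. m k = 1" "\<lambda>_. 1"] by simp
  qed auto
  then obtain \<delta>' where \<delta>': "0 < \<delta>'" "\<And>X. 0 < X \<Longrightarrow> X < \<delta>' \<Longrightarrow> \<forall>t. (\<Sum>k=1..M. lam k * r k t * up k X) \<le> b t"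
    by (auto simp: eventually_at_right_field)
  have "\<forall>\<^sub>F X in at_top. \<forall>t. b t \<le> (\<Sum>k=1..M. lam k * r k t * low k X)"
  proof (rule eventually_weighted_sum_ge[OF _ T_gt_0 weight_coeff low_at_top[OF _ m_le] b_coeff])
    show "b t < (\<Sum>k=1..M. lam k * r k t * (of_bool (m k = n k + 1) * exp (- C * m k)))" for t
      using large[of t] by (simp only: sum_mult_of_bool[OF finite_atLeastAtMost])
  qed auto
  then obtain R where R: "\<And>X. R \<le> X \<Longrightarrow> \<forall>t. b t \<le> (\<Sum>k=1..M. lam k * r k t * low k X)"
    by (auto simp: eventually_at_top_linorder)
  show ?thesis
  \<comment> \<open>The sign \<open>- 1\<close> reverses this expansive situation. Halving
    \<open>\<delta>'\<close> passes from the strict bound \<open>X < \<delta>'\<close> to a weak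
    one.\<close>
  proof (rule production_solution[of "- 1" "\<delta>' / 2" R])
    fix x t X
    assume X: "0 < X" "x \<in> periodic_band T (exp (- C) * X) X"
    show "0 \<le> - 1 * (production x t - b t * X)" if "X \<le> \<delta>' / 2"
      using production_le[OF \<delta>'(2) X, of t] X that by simp
    show "- 1 * (production x t - b t * X) \<le> 0" if "R \<le> X"
      using production_ge[OF R X, of t] that by simp
  qed (use \<delta>' in auto)
qed

text \<open>Production dominates for small \<open>X\<close> because the single term \<open>i\<close>
  is already unbounded relative to \<open>X\<close>; consumption dominates for large
  \<open>X\<close> by the limit of \<open>up\<close> at infinity.\<close>

lemma sublinear_solution:
  assumes i: "i \<in> {1..M}" "m i < 1" and m_le: "\<And>k. k \<in> {1..M} \<Longrightarrow> m k \<le> n k + 1"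
    and large: "\<And>t. (\<Sum>k | k \<in> {1..M} \<and> m k = n k + 1. lam k * r k t * exp (C * n k)) < b t"
  shows "\<exists>x. positive_periodic_solution T M lam m n r \<tau> \<mu> b x"
proof -
  obtain d where d: "\<And>t. b t \<le> d"
    using positive_periodic_coeff_bounds[OF b_coeff T_gt_0] by metis
  obtain c where c: "0 < c" "\<And>t. c \<le> lam i * r i t"
    using positive_periodic_coeff_bounds[OF weight_coeff[OF i(1)] T_gt_0] by metis
  have low_nonneg: "0 \<le> low k X" for k X
    by (simp add: low_def add_nonneg_nonneg)
  \<comment> \<open>With \<open>b \<le> d\<close> and weight at least \<open>c\<close>, this makes
    term \<open>i\<close> alone exceed \<open>b\<close>; the remaining terms are
    nonnegative.\<close>
  have "\<forall>\<^sub>F X in at_right 0. d / c \<le> low i X"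
    using low_at_0[OF i] by (simp add: filterlim_at_top)
  then have "\<forall>\<^sub>F X in at_right 0. \<forall>t. b t \<le> (\<Sum>k=1..M. lam k * r k t * low k X)"
  proof eventually_elim
    case (elim X)
    show ?case
    proof
      fix t
      have "b t \<le> c * low i X"
        using d[of t] elim c(1) by (simp add: field_simps)
      also have "\<dots> \<le> lam i * r i t * low i X"
        using c by (intro mult_right_mono low_nonneg)
      also have "\<dots> \<le> (\<Sum>k=1..M. lam k * r k t * low k X)"
        using i(1) by (intro member_le_sum mult_nonneg_nonneg weight_nonneg low_nonneg) auto
      finally show "b t \<le> (\<Sum>k=1..M. lam k * r k t * low k X)" .
    qed
  qed
  then obtain \<delta>' where \<delta>': "0 < \<delta>'" "\<And>X. 0 < X \<Longrightarrow> X < \<delta>' \<Longrightarrow> \<forall>t. b t \<le> (\<Sum>k=1..M. lam k * r k t * low k X)"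
    by (auto simp: eventually_at_right_field)
  have "\<forall>\<^sub>F X in at_top. \<forall>t. (\<Sum>k=1..M. lam k * r k t * up k X) \<le> b t"
  proof (rule eventually_weighted_sum_le[OF _ T_gt_0 weight_coeff up_at_top[OF _ m_le] b_coeff])
    show "(\<Sum>k=1..M. lam k * r k t * (of_bool (m k = n k + 1) * exp (C * n k))) < b t" for t
      using large[of t] by (simp only: sum_mult_of_bool[OF finite_atLeastAtMost])
  qed auto
  then obtain R where R: "\<And>X. R \<le> X \<Longrightarrow> \<forall>t. (\<Sum>k=1..M. lam k * r k t * up k X) \<le> b t"
    by (auto simp: eventually_at_top_linorder)
  show ?thesis
  proof (rule production_solution[of 1 "\<delta>' / 2" R])
    fix x t X
    assume X: "0 < X" "x \<in> periodic_band T (exp (- C) * X) X"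
    show "0 \<le> 1 * (production x t - b t * X)" if "X \<le> \<delta>' / 2"
      using production_ge[OF \<delta>'(2) X, of t] X that by simp
    show "1 * (production x t - b t * X) \<le> 0" if "R \<le> X"
      using production_le[OF R X, of t] that by simp
  qed (use \<delta>' in auto)
qed

end

theorem theorem2p3:
  fixes T C :: real and M :: nat
    and lam m n :: "nat \<Rightarrow> real"
    and r \<tau> \<mu> :: "nat \<Rightarrow> real \<Rightarrow> real"
    and b :: "real \<Rightarrow> real"
    and M2 M4 :: "nat set"
  assumes "T > 0" and "M \<ge> 1"
    and "\<And>k. k \<in> {1..M} \<Longrightarrow> lam k > 0 \<and> m k > 0 \<and> n k > 0"
    and "\<And>k. k \<in> {1..M} \<Longrightarrow> positive_periodic_coeff T (r k) \<and>
           positive_periodic_coeff T (\<tau> k) \<and> positive_periodic_coeff T (\<mu> k)"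
    and "positive_periodic_coeff T b"
    and C_def: "C = integral {0..T} b"
    and M2_def: "M2 = {k \<in> {1..M}. m k = 1}"
    and M4_def: "M4 = {k \<in> {1..M}. m k = n k + 1}"
    and "\<And>k. k \<in> {1..M} \<Longrightarrow> m k \<le> n k + 1"
    and "\<exists>j\<in>{1..M}. m j = n j + 1"
    and "((\<forall>k\<in>{1..M}. m k > 1) \<and>
          (\<forall>t. (\<Sum>k\<in>M4. lam k * r k t * exp (- C * m k)) > b t))
       \<or> ((\<forall>k\<in>{1..M}. m k \<ge> 1) \<and> (\<exists>i\<in>{1..M}. m i = 1) \<and>
          (\<forall>t. (\<Sum>k\<in>M4. lam k * r k t * exp (- C * m k)) > b t) \<and>
          (\<forall>t. (\<Sum>k\<in>M2. lam k * r k t * exp C) < b t))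
       \<or> ((\<exists>i\<in>{1..M}. 0 < m i \<and> m i < 1) \<and>
          (\<forall>t. (\<Sum>k\<in>M4. lam k * r k t * exp (C * n k)) < b t))"
  shows "\<exists>x. positive_periodic_solution T M lam m n r \<tau> \<mu> b x"
proof -
  note eqn = assms(1-6)
  note b_pos = positive_periodic_coeffD(3)[OF assms(5)]
  have "0 \<le> C"
    using \<open>T > 0\<close> positive_periodic_coeffD(1)[OF assms(5)] b_pos unfolding C_def
    by (intro integral_nonneg integrable_continuous_interval)
       (auto intro: continuous_on_subset less_imp_le)
  have m_le: "\<And>k. k \<in> {1..M} \<Longrightarrow> m k \<le> n k + 1" by fact
  \<comment> \<open>Since \<open>exp C \<ge> 1\<close>, the condition on \<open>M2\<close> in case 2
    yields the smallness hypothesis of \<open>superlinear_solution\<close>.\<close>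
  have M2: "(\<Sum>k | k \<in> {1..M} \<and> m k = 1. lam k * r k t) \<le> (\<Sum>k\<in>M2. lam k * r k t * exp C)" for t
  proof -
    have "lam k * r k t * 1 \<le> lam k * r k t * exp C" if "k \<in> {1..M}" for k
      using weight_nonneg[OF eqn that] \<open>0 \<le> C\<close> by (intro mult_left_mono) auto
    then show ?thesis unfolding M2_def by (intro sum_mono) auto
  qed
  from assms(11) show ?thesis
  proof (elim disjE conjE)
    assume m: "\<forall>k\<in>{1..M}. 1 < m k"
      and large: "\<forall>t. b t < (\<Sum>k\<in>M4. lam k * r k t * exp (- C * m k))"
    \<comment> \<open>In case 1 the sum over exponents equal to 1 is empty, so the smallness
      hypothesis reduces to \<open>b > 0\<close>.\<close>
    have no_M2: "{k. k \<in> {1..M} \<and> m k = 1} = {}" using m by force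
    show ?thesis
    proof (rule superlinear_solution)
      show "(\<Sum>k | k \<in> {1..M} \<and> m k = 1. lam k * r k t) < b t" for t
        using b_pos[of t] by (simp only: no_M2 sum.empty)
      show "b t < (\<Sum>k | k \<in> {1..M} \<and> m k = n k + 1. lam k * r k t * exp (- C * m k))" for t
        using large unfolding M4_def by blast
      show "1 \<le> m k" if "k \<in> {1..M}" for k
        using m that by (blast intro: less_imp_le)
    qed (fact eqn m_le)+
  next
    assume m: "\<forall>k\<in>{1..M}. 1 \<le> m k"
      and large: "\<forall>t. b t < (\<Sum>k\<in>M4. lam k * r k t * exp (- C * m k))"
      and small: "\<forall>t. (\<Sum>k\<in>M2. lam k * r k t * exp C) < b t"
    show ?thesis
    proof (rule superlinear_solution)
      show "(\<Sum>k | k \<in> {1..M} \<and> m k = 1. lam k * r k t) < b t" for t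
        using le_less_trans[OF M2 small[rule_format]] .
      show "b t < (\<Sum>k | k \<in> {1..M} \<and> m k = n k + 1. lam k * r k t * exp (- C * m k))" for t
        using large unfolding M4_def by blast
      show "1 \<le> m k" if "k \<in> {1..M}" for k
        using m that by blast
    qed (fact eqn m_le)+
  next
    assume "\<exists>i\<in>{1..M}. 0 < m i \<and> m i < 1"
      and large: "\<forall>t. (\<Sum>k\<in>M4. lam k * r k t * exp (C * n k)) < b t"
    then obtain i where i: "i \<in> {1..M}" "m i < 1" by blast
    show ?thesis
    proof (rule sublinear_solution)
      show "(\<Sum>k | k \<in> {1..M} \<and> m k = n k + 1. lam k * r k t * exp (C * n k)) < b t" for t
        using large unfolding M4_def by blast
    qed (fact eqn i m_le)+
  qed
qed

end
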